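(* Let $\underline{h}=(h_0,h_1,\dots,h_e)$ be a finite $O$-sequence. Then $\underline{h}$ is the "first half" of a pure $O$-sequence (i.e. there exists a pure $O$-sequence $(H_0,H_1,\dots,H_E)$ with $\lfloor E/2\rfloor=e$ and $H_i=h_i$ for all $0\le i\le e$) if and only if $\underline{h}$ is differentiable.
   Context: For a positive integer $n$ and positive integer $d$, write $n=\binom{k_d}{d}+\binom{k_{d-1}}{d-1}+\cdots+\binom{k_\delta}{\delta}$ with $k_d>k_{d-1}>\dots>k_\delta\ge\delta\ge1$ (the unique $d$-binomial expansion), and set $(n_{(d)})^b_a=\binom{k_d+b}{d+a}+\cdots+\binom{k_\delta+b}{\delta+a}$, with $\binom{m}{p}=0$ if $p<0$ or $m<p$; set $(0_{(d)})^b_a=0$. A sequence $(h_0,\dots,h_e)$ of non-negative integers with $h_0=1$ is an $O$-sequence if $h_{d+1}\le ((h_d)_{(d)})^1_1$ for all $1\le d<e$ (equivalently, it is the Hilbert function of a standard graded algebra). A monomial order ideal is a finite nonempty set $X$ of monomials in some variables such that whenever $M\in X$ and $N\mid M$ then $N\in X$; it is pure if all maximal monomials (under divisibility) have the same degree $e$ (the socle degree). A pure $O$-sequence is the vector $(h_0,\dots,h_e)$ where $h_i$ is the number of monomials of degree $i$ in a pure monomial order ideal of socle degree $e$. A sequence $(h_0,\dots,h_e)$ is differentiable if $(h_0,h_1-h_0,h_2-h_1,\dots,h_e-h_{e-1})$ is an $O$-sequence. *)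

theory Defs
  imports Complex_Main "HOL-Library.Multiset"
begin

definition binom :: "int \<Rightarrow> int \<Rightarrow> nat" where
  "binom m p = (if p < 0 \<or> m < p then 0 else nat m choose nat p)"

text \<open>The coefficients of the expansion are \<open>k d > k (d - 1) > \<dots> > k \<delta>\<close>;
  the values of \<open>k\<close> outside \<open>{\<delta>..d}\<close> are irrelevant.\<close>

definition binomial_expansion :: "nat \<Rightarrow> nat \<Rightarrow> nat \<Rightarrow> (nat \<Rightarrow> nat) \<Rightarrow> bool" where
  "binomial_expansion n d \<delta> k \<longleftrightarrow>
     1 \<le> \<delta> \<and> \<delta> \<le> d \<and> \<delta> \<le> k \<delta> \<and> (\<forall>i. \<delta> \<le> i \<and> i < d \<longrightarrow> k i < k (Suc i)) \<and>
     n = (\<Sum>i=\<delta>..d. k i choose i)"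

text \<open>\<open>binomial_shift n d b a\<close> is $(n_{(d)})^b_a$. For positive \<open>n\<close> and \<open>d\<close> the expansion
  exists and is unique, so the description below is proper.\<close>

definition binomial_shift :: "nat \<Rightarrow> nat \<Rightarrow> int \<Rightarrow> int \<Rightarrow> nat" where
  "binomial_shift n d b a =
     (if n = 0 then 0
      else (THE v. \<exists>\<delta> k. binomial_expansion n d \<delta> k \<and>
                     v = (\<Sum>i=\<delta>..d. binom (int (k i) + b) (int i + a))))"

text \<open>A finite sequence $(h_0,\dots,h_e)$ is given by \<open>e\<close> and a function of which only the values
  on \<open>{0..e}\<close> matter. Entries are integers, because the differences of an O-sequence can be
  negative; non-negativity is then part of being an O-sequence.\<close>

definition O_sequence :: "nat \<Rightarrow> (nat \<Rightarrow> int) \<Rightarrow> bool" where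
  "O_sequence e h \<longleftrightarrow>
     (\<forall>i\<le>e. 0 \<le> h i) \<and> h 0 = 1 \<and>
     (\<forall>d. 1 \<le> d \<and> d < e \<longrightarrow> h (d + 1) \<le> int (binomial_shift (nat (h d)) d 1 1))"

definition differentiable_sequence :: "nat \<Rightarrow> (nat \<Rightarrow> int) \<Rightarrow> bool" where
  "differentiable_sequence e h \<longleftrightarrow>
     O_sequence e (\<lambda>i. if i = 0 then h 0 else h i - h (i - 1))"

text \<open>A monomial in variables of type \<open>'v\<close> is the multiset of its variables, so that divisibility
  is \<open>\<subseteq>#\<close> and the degree is \<open>size\<close>.\<close>

definition monomial_order_ideal :: "'v multiset set \<Rightarrow> bool" where
  "monomial_order_ideal X \<longleftrightarrow>
     finite X \<and> X \<noteq> {} \<and> (\<forall>M\<in>X. \<forall>N. N \<subseteq># M \<longrightarrow> N \<in> X)"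

definition maximal_monomial :: "'v multiset set \<Rightarrow> 'v multiset \<Rightarrow> bool" where
  "maximal_monomial X M \<longleftrightarrow> M \<in> X \<and> (\<forall>N\<in>X. M \<subseteq># N \<longrightarrow> N = M)"

definition pure_order_ideal :: "nat \<Rightarrow> 'v multiset set \<Rightarrow> bool" where
  "pure_order_ideal e X \<longleftrightarrow>
     monomial_order_ideal X \<and> (\<forall>M. maximal_monomial X M \<longrightarrow> size M = e)"

text \<open>An order ideal is finite, so it involves only finitely many variables, and these may be
  taken to be indexed by natural numbers.\<close>

definition pure_O_sequence :: "nat \<Rightarrow> (nat \<Rightarrow> int) \<Rightarrow> bool" where
  "pure_O_sequence e h \<longleftrightarrow>
     (\<exists>X :: nat multiset set. pure_order_ideal e X \<and>
        (\<forall>i\<le>e. h i = int (card {M \<in> X. size M = i})))"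

end

theory Submission
  imports Defs "HOL-Library.Multiset_Order"
begin

text \<open>Let \<open>X\<close> be a pure order ideal of socle degree \<open>E\<close> and \<open>A\<close> the monomial algebra it spans. The algebra
  spanned by the divisors of a single monomial of degree \<open>E\<close> carries an $\mathfrak{sl}_2$-action, so
  multiplication by the sum \<open>\<ell>\<close> of the variables is injective below the middle degree; by purity this
  passes to \<open>A\<close> (Hausel). Hence the first half of the first difference of \<open>h\<close> is the Hilbert function
  of \<open>A/\<ell>A\<close>, that is, of the order ideal of leading monomials of the inverse system of \<open>A/\<ell>A\<close>, and it
  is an O-sequence by Macaulay's theorem. The latter is proved by compressing to a family stable under
  replacing any variable by a fixed one, followed by Green's induction.

  Conversely, if the first difference is an O-sequence, initial segments of the multiset order give an
  order ideal \<open>Y\<close> with this Hilbert function. With a new variable \<open>z\<close>, the monomials \<open>m z\<^sup>j\<close> with \<open>m\<close> in \<open>Y\<close>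
  and total degree at most \<open>2 e\<close> form a pure order ideal, whose Hilbert function up to degree \<open>e\<close> sums
  that of \<open>Y\<close>.\<close>

section \<open>Binomial expansions\<close>

lemma binom_Pascal:
  assumes "1 \<le> p"
  shows "binom m p = binom (m - 1) p + binom (m - 1) (p - 1)"
proof (cases "m < p")
  case False
  obtain n where n: "m = int (Suc n)"
    using False assms by (intro that[of "nat (m - 1)"]) auto
  obtain q where q: "p = int (Suc q)"
    using assms by (intro that[of "nat (p - 1)"]) auto
  have "q \<le> n" using False n q by simp
  then show ?thesis
    by (simp add: binom_def n q nat_add_distrib)
qed (use assms in \<open>auto simp: binom_def\<close>)

lemma binom_of_nat: "binom (int m) (int p) = m choose p"
  by (simp add: binom_def binomial_eq_0)

text \<open>Peels off the leading coefficient for inductions on \<open>d\<close>. In the first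
  disjunct the expansion stops there; in the second the remainder has an expansion of its
  own.\<close>

lemma binomial_expansion_Suc:
  "binomial_expansion n (Suc d) \<delta> k \<longleftrightarrow>
     (\<delta> = Suc d \<and> Suc d \<le> k (Suc d) \<and> n = k (Suc d) choose Suc d) \<or>
     (\<delta> \<le> d \<and> k d < k (Suc d) \<and>
       (\<exists>n'. n = n' + (k (Suc d) choose Suc d) \<and> binomial_expansion n' d \<delta> k))"
proof (cases "\<delta> \<le> d")
  case True
  then have "(\<Sum>i=\<delta>..Suc d. k i choose i) = (\<Sum>i=\<delta>..d. k i choose i) + (k (Suc d) choose Suc d)"
    by (simp add: sum.nat_ivl_Suc')
  moreover have "(\<forall>i. \<delta> \<le> i \<and> i < Suc d \<longrightarrow> k i < k (Suc i)) \<longleftrightarrow>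
      k d < k (Suc d) \<and> (\<forall>i. \<delta> \<le> i \<and> i < d \<longrightarrow> k i < k (Suc i))"
    using True by (auto simp: less_Suc_eq)
  ultimately show ?thesis
    using True unfolding binomial_expansion_def by auto
next
  case False
  then show ?thesis
    unfolding binomial_expansion_def by (cases "\<delta> = Suc d") auto
qed

lemma binomial_expansion_index_le:
  assumes "binomial_expansion n d \<delta> k"
  shows "\<delta> \<le> i \<Longrightarrow> i \<le> d \<Longrightarrow> i \<le> k i"
proof (induction i rule: nat_induct_at_least)
  case base then show ?case using assms by (simp add: binomial_expansion_def)
next
  case (Suc i)
  then have "k i < k (Suc i)" using assms by (simp add: binomial_expansion_def)
  then show ?case using Suc by simp
qed

text \<open>By induction and strict increase of the coefficients, the lower terms add up to less
  than \<open>k (Suc d) choose d\<close>; Pascal's rule then gives the upper bound. Hence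
  \<open>n\<close> determines the leading coefficient.\<close>

lemma binomial_expansion_bounds:
  "binomial_expansion n d \<delta> k \<Longrightarrow> (k d choose d) \<le> n \<and> n < (Suc (k d) choose d) \<and> 0 < n \<and> d \<le> k d"
proof (induction d arbitrary: n)
  case 0 then show ?case by (auto simp: binomial_expansion_def)
next
  case (Suc d)
  show ?case
  proof (cases "\<delta> \<le> d")
    case True
    then obtain n' where n': "n = n' + (k (Suc d) choose Suc d)" "binomial_expansion n' d \<delta> k" "k d < k (Suc d)"
      using Suc.prems by (auto simp: binomial_expansion_Suc)
    have "n' < Suc (k d) choose d" "d \<le> k d" "0 < n'" using Suc.IH[OF n'(2)] by auto
    moreover have "(Suc (k d) choose d) \<le> (k (Suc d) choose d)"
      using n'(3) by (intro binomial_right_mono) simp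
    ultimately show ?thesis using n' by auto
  next
    case False
    then have "Suc d \<le> k (Suc d)" "n = k (Suc d) choose Suc d"
      using Suc.prems by (auto simp: binomial_expansion_Suc)
    then show ?thesis by (auto simp: zero_less_binomial_iff)
  qed
qed

text \<open>The bounds fix the leading coefficient, and positivity of the remainder decides whether
  the expansion goes on; induction treats the remainder.\<close>

lemma binomial_expansion_unique:
  "binomial_expansion n d \<delta> k \<Longrightarrow> binomial_expansion n d \<delta>' k' \<Longrightarrow> \<delta> = \<delta>' \<and> (\<forall>i\<in>{\<delta>..d}. k i = k' i)"
proof (induction d arbitrary: n)
  case 0 then show ?case by (auto simp: binomial_expansion_def)
next
  case (Suc d)
  note b = binomial_expansion_bounds[OF Suc.prems(1)] and b' = binomial_expansion_bounds[OF Suc.prems(2)]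
  have aux: "a \<le> b" if "a choose Suc d \<le> n" "n < Suc b choose Suc d" for a b
  proof (rule ccontr)
    assume "\<not> a \<le> b"
    then have "(Suc b choose Suc d) \<le> (a choose Suc d)"
      by (intro binomial_right_mono) simp
    then show False using that by linarith
  qed
  have eq: "k (Suc d) = k' (Suc d)"
    using aux[of "k (Suc d)" "k' (Suc d)"] aux[of "k' (Suc d)" "k (Suc d)"] b b' by simp
  show ?case
  proof (cases "\<delta> \<le> d")
    case True
    then obtain n' where n': "n = n' + (k (Suc d) choose Suc d)" "binomial_expansion n' d \<delta> k"
      using Suc.prems by (auto simp: binomial_expansion_Suc)
    have "0 < n'" using binomial_expansion_bounds[OF n'(2)] by simp
    then have "binomial_expansion n' d \<delta>' k'"
      using Suc.prems(2) n'(1) eq by (auto simp: binomial_expansion_Suc)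
    then show ?thesis using Suc.IH[OF n'(2)] eq by (auto simp: le_Suc_eq)
  next
    case False
    then have 1: "\<delta> = Suc d" "n = k (Suc d) choose Suc d"
      using Suc.prems by (auto simp: binomial_expansion_Suc)
    have "\<delta>' = Suc d"
      using Suc.prems(2) 1 eq by (auto simp: binomial_expansion_Suc dest: binomial_expansion_bounds)
    then show ?thesis using 1 eq by auto
  qed
qed

text \<open>Greedy algorithm: take the largest \<open>K\<close> with
  \<open>K choose Suc d \<le> n\<close> and expand what remains.\<close>

lemma binomial_expansion_exists:
  "1 \<le> d \<Longrightarrow> 0 < n \<Longrightarrow> \<exists>\<delta> k. binomial_expansion n d \<delta> k"
proof (induction d arbitrary: n rule: nat_induct_at_least)
  case base
  then have "binomial_expansion n 1 1 (\<lambda>_. n)" by (auto simp: binomial_expansion_def)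
  then show ?case by blast
next
  case (Suc d)
  let ?P = "\<lambda>m. m choose Suc d \<le> n"
  \<comment> \<open>\<open>GREATEST\<close> needs an upper bound: \<open>m > n + d\<close> would
    give \<open>m choose Suc d > n\<close>.\<close>
  have bound: "m \<le> n + d" if "?P m" for m
  proof (rule ccontr)
    assume "\<not> m \<le> n + d"
    then have "((Suc n + d) choose Suc d) \<le> (m choose Suc d)"
      by (intro binomial_right_mono) simp
    moreover have "Suc n + d choose Suc d \<ge> Suc n"
    proof -
      have "(Suc n + j) choose Suc j \<ge> Suc n" for j
        by (induction j) auto
      then show ?thesis .
    qed
    ultimately show False using that by linarith
  qed
  define K where "K = (GREATEST m. ?P m)"
  have P: "?P (Suc d)" using Suc.prems by simp
  have K1: "?P K" unfolding K_def
    by (rule GreatestI_nat[where P = ?P and b = "n + d", OF P]) (use bound in blast)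
  have K2: "Suc d \<le> K" unfolding K_def
    by (rule Greatest_le_nat[where P = ?P and b = "n + d", OF P]) (use bound in blast)
  have K3: "\<not> ?P (Suc K)"
  proof
    assume "?P (Suc K)"
    then have "Suc K \<le> K" unfolding K_def
      by (rule Greatest_le_nat[where P = ?P and b = "n + d"]) (use bound in blast)
    then show False by simp
  qed
  define n' where "n' = n - (K choose Suc d)"
  have n: "n = n' + (K choose Suc d)" using K1 by (simp add: n'_def)
  \<comment> \<open>Maximality of \<open>K\<close> and Pascal's rule; this forces the next
    coefficient below \<open>K\<close>.\<close>
  have n'K: "n' < K choose d" using K3 n by simp
  show ?case
  proof (cases "n' = 0")
    case True
    then have "binomial_expansion n (Suc d) (Suc d) (\<lambda>_. K)"
      using n K2 by (simp add: binomial_expansion_Suc)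
    then show ?thesis by blast
  next
    case False
    then obtain \<delta> k where k: "binomial_expansion n' d \<delta> k" using Suc.IH[of n'] by auto
    have "(k d choose d) < (K choose d)"
      using n'K binomial_expansion_bounds[OF k] by linarith
    then have "k d < K" using binomial_right_mono[of K "k d" d] by (meson not_less)
    moreover have "binomial_expansion n' d \<delta> (k(Suc d := K))"
    proof -
      have "(\<Sum>i=\<delta>..d. (k(Suc d := K)) i choose i) = (\<Sum>i=\<delta>..d. k i choose i)"
        by (intro sum.cong) auto
      then show ?thesis using k unfolding binomial_expansion_def by auto
    qed
    moreover have "\<delta> \<le> d" using k by (simp add: binomial_expansion_def)
    ultimately have "binomial_expansion n (Suc d) \<delta> (k(Suc d := K))"
      using n by (auto simp: binomial_expansion_Suc)
    then show ?thesis by blast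
  qed
qed

lemma binomial_shift_eq:
  assumes "binomial_expansion n d \<delta> k"
  shows "binomial_shift n d b a = (\<Sum>i=\<delta>..d. binom (int (k i) + b) (int i + a))"
proof -
  have "n \<noteq> 0" using binomial_expansion_bounds[OF assms] by simp
  moreover have "(THE v. \<exists>\<delta> k. binomial_expansion n d \<delta> k \<and> v = (\<Sum>i=\<delta>..d. binom (int (k i) + b) (int i + a)))
      = (\<Sum>i=\<delta>..d. binom (int (k i) + b) (int i + a))"
  proof (rule the_equality)
    fix v assume "\<exists>\<delta> k. binomial_expansion n d \<delta> k \<and> v = (\<Sum>i=\<delta>..d. binom (int (k i) + b) (int i + a))"
    then obtain \<delta>' k' where "binomial_expansion n d \<delta>' k'"
      and v: "v = (\<Sum>i=\<delta>'..d. binom (int (k' i) + b) (int i + a))" by blast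
    then have "\<delta> = \<delta>'" "\<forall>i\<in>{\<delta>..d}. k i = k' i"
      using binomial_expansion_unique[OF assms] by blast+
    then show "v = (\<Sum>i=\<delta>..d. binom (int (k i) + b) (int i + a))"
      unfolding v by (intro sum.cong) auto
  qed (use assms in blast)
  ultimately show ?thesis by (simp add: binomial_shift_def)
qed

section \<open>Macaulay's bound on the growth of order ideals\<close>

definition shadow :: "'a multiset set \<Rightarrow> 'a multiset set" where
  "shadow F = {N. \<exists>x. add_mset x N \<in> F}"

definition shift_stable :: "'a \<Rightarrow> 'a multiset set \<Rightarrow> bool" where
  "shift_stable x F \<longleftrightarrow> (\<forall>N y. add_mset y N \<in> F \<longrightarrow> add_mset x N \<in> F)"

lemma shadow_multisets_of_size: "F \<subseteq> multisets_of_size V (Suc d) \<Longrightarrow> shadow F \<subseteq> multisets_of_size V d"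
  by (fastforce simp: shadow_def multisets_of_size_def)

text \<open>In a stable family a factor \<open>y\<close> can be traded for \<open>x\<close>, so
  dividing by \<open>x\<close> alone yields the whole shadow.\<close>

lemma stable_shadow_eq: "shift_stable x F \<Longrightarrow> shadow F = {N. add_mset x N \<in> F}"
  by (auto simp: shift_stable_def shadow_def)

lemma stable_shadow: "shift_stable x F \<Longrightarrow> shift_stable x (shadow F)"
  unfolding shift_stable_def shadow_def mem_Collect_eq by (metis add_mset_commute)

text \<open>Multiplication by \<open>x\<close> identifies the shadow of a stable family with its
  members divisible by \<open>x\<close>.\<close>

lemma card_stable:
  assumes "finite F" "shift_stable x F"
  shows "card F = card {M \<in> F. x \<notin># M} + card (shadow F)"
proof -
  have "F = {M \<in> F. x \<notin># M} \<union> add_mset x ` shadow F"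
    unfolding stable_shadow_eq[OF assms(2)] by (auto dest!: multi_member_split)
  moreover have "finite (shadow F)"
  proof (rule finite_subset)
    show "shadow F \<subseteq> (\<lambda>M. M - {#x#}) ` F"
      unfolding stable_shadow_eq[OF assms(2)] by force
  qed (use assms in simp)
  then have "card ({M \<in> F. x \<notin># M} \<union> add_mset x ` shadow F) =
      card {M \<in> F. x \<notin># M} + card (add_mset x ` shadow F)"
    using assms by (intro card_Un_disjoint) auto
  moreover have "card (add_mset x ` shadow F) = card (shadow F)"
    by (intro card_image) (auto simp: inj_on_def)
  ultimately show ?thesis by simp
qed

lemma shadow_free_subset: "shadow {M \<in> F. x \<notin># M} \<subseteq> {M \<in> shadow F. x \<notin># M}"
  by (auto simp: shadow_def)

text \<open>A combinatorial form of Green's hyperplane restriction theorem. If the \<open>x\<close>-free part \<open>F\<^sub>0\<close> were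
  too large, the shadow of \<open>F\<close> would be small, so by induction on the degree its \<open>x\<close>-free part would be
  small too. The latter contains the shadow of \<open>F\<^sub>0\<close>, and Macaulay's bound in fewer variables
  bounds \<open>F\<^sub>0\<close>.\<close>

lemma Green_stable:
  assumes "finite V"
  and Macaulay: "\<And>F d \<delta> (k :: nat \<Rightarrow> int). F \<subseteq> multisets_of_size V (Suc d) \<Longrightarrow> 1 \<le> \<delta> \<Longrightarrow>
        card (shadow F) \<le> (\<Sum>i=\<delta>..d. binom (k i) (int i)) \<Longrightarrow>
        card F \<le> (\<Sum>i=\<delta>..d. binom (k i + 1) (int i + 1))"
  shows "F \<subseteq> multisets_of_size (insert x V) d \<Longrightarrow> shift_stable x F \<Longrightarrow> 1 \<le> \<delta> \<Longrightarrow>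
     card F \<le> (\<Sum>i=\<delta>..d. binom (k i) (int i)) \<Longrightarrow>
     card {M \<in> F. x \<notin># M} \<le> (\<Sum>i=\<delta>..d. binom (k i - 1) (int i))"
proof (induction d arbitrary: F \<delta> k)
  case 0
  have "finite F" using 0(1) by (rule finite_subset) auto
  then have "F = {}" using 0 by simp
  then show ?case by simp
next
  case (Suc d)
  let ?F0 = "{M \<in> F. x \<notin># M}"
  have fin: "finite F" using Suc.prems(1) by (rule finite_subset) (use assms in \<open>auto intro: finite_multisets_of_size\<close>)
  have finS: "finite (shadow F)"
    using shadow_multisets_of_size[OF Suc.prems(1)]
    by (rule finite_subset) (use assms in \<open>auto intro: finite_multisets_of_size\<close>)
  show ?case
  proof (rule ccontr)
    assume "\<not> ?case"
    then have large: "(\<Sum>i=\<delta>..Suc d. binom (k i - 1) (int i)) < card ?F0" by simp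
    \<comment> \<open>Pascal's rule splits the bound for \<open>F\<close> into the bound claimed for
      the \<open>x\<close>-free part and a rest, which is left for the shadow.\<close>
    have "(\<Sum>i=\<delta>..Suc d. binom (k i) (int i)) =
        (\<Sum>i=\<delta>..Suc d. binom (k i - 1) (int i)) + (\<Sum>i=\<delta>..Suc d. binom (k i - 1) (int i - 1))"
      unfolding sum.distrib[symmetric] using Suc.prems(3) by (intro sum.cong refl binom_Pascal) auto
    then have small: "card (shadow F) < (\<Sum>i=\<delta>..Suc d. binom (k i - 1) (int i - 1))"
      using large Suc.prems(4) card_stable[OF fin Suc.prems(2)] by linarith
    \<comment> \<open>Passing to degree \<open>d\<close> lowers every index by one. Index 1 would
      become 0, outside the range of the induction hypothesis, so the sum is made to start at index
      2 or later.\<close>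
    define \<delta>' where "\<delta>' = max \<delta> 2 - 1"
    have \<delta>': "1 \<le> \<delta>'" "\<delta> \<le> Suc \<delta>'" by (auto simp: \<delta>'_def)
    have reindex: "(\<Sum>i=\<delta>'..d. f (Suc i)) = (\<Sum>i=Suc \<delta>'..Suc d. f i)" for f :: "nat \<Rightarrow> nat"
      by (rule sum.shift_bounds_cl_Suc_ivl[symmetric])
    have "card (shadow F) \<le> (\<Sum>i=Suc \<delta>'..Suc d. binom (k i - 1) (int i - 1))"
    proof (cases "\<delta> = 1")
      \<comment> \<open>Dropping the term of index 1 costs at most 1, which the strict inequality in
        \<open>small\<close> pays for.\<close>
      case True
      have "(\<Sum>i=1..Suc d. binom (k i - 1) (int i - 1)) =
          binom (k 1 - 1) 0 + (\<Sum>i=2..Suc d. binom (k i - 1) (int i - 1))"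
        by (subst sum.atLeast_Suc_atMost) (auto simp: numeral_2_eq_2)
      moreover have "binom (k 1 - 1) 0 \<le> 1" by (simp add: binom_def)
      ultimately show ?thesis using small True by (simp add: \<delta>'_def numeral_2_eq_2)
    next
      case False
      then have "Suc \<delta>' = \<delta>" using Suc.prems(3) by (simp add: \<delta>'_def)
      then show ?thesis using small by simp
    qed
    then have "card (shadow F) \<le> (\<Sum>i=\<delta>'..d. binom (k (Suc i) - 1) (int i))"
      unfolding reindex[of "\<lambda>i. binom (k i - 1) (int i - 1)", symmetric] by simp
    from Suc.IH[OF shadow_multisets_of_size[OF Suc.prems(1)] stable_shadow[OF Suc.prems(2)] \<delta>'(1) this]
    have "card {M \<in> shadow F. x \<notin># M} \<le> (\<Sum>i=\<delta>'..d. binom (k (Suc i) - 1 - 1) (int i))" .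
    moreover have "card (shadow ?F0) \<le> card {M \<in> shadow F. x \<notin># M}"
      using finS by (intro card_mono shadow_free_subset) auto
    ultimately have "card (shadow ?F0) \<le> (\<Sum>i=\<delta>'..d. binom (k (Suc i) - 1 - 1) (int i))"
      by linarith
    moreover have "?F0 \<subseteq> multisets_of_size V (Suc d)"
      using Suc.prems(1) by (auto simp: multisets_of_size_def)
    ultimately have "card ?F0 \<le> (\<Sum>i=\<delta>'..d. binom (k (Suc i) - 1 - 1 + 1) (int i + 1))"
      using Macaulay[of ?F0 d \<delta>' "\<lambda>i. k (Suc i) - 1 - 1"] \<delta>'(1) by simp
    also have "\<dots> = (\<Sum>i=Suc \<delta>'..Suc d. binom (k i - 1) (int i))"
      unfolding reindex[of "\<lambda>i. binom (k i - 1) (int i)", symmetric] by (simp add: add.commute)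
    also have "\<dots> \<le> (\<Sum>i=\<delta>..Suc d. binom (k i - 1) (int i))"
      using \<delta>' by (intro sum_mono2) auto
    finally show False using large by simp
  qed
qed

text \<open>The fibre of \<open>M\<close> records the exponents of \<open>y\<close> in those members of \<open>F\<close> that differ from \<open>M\<close> only in
  how a fixed total degree is distributed between \<open>x\<close> and \<open>y\<close>. Compression pushes each fibre down to
  an initial interval, which moves weight from \<open>y\<close> to \<open>x\<close>.\<close>

definition slide :: "'a \<Rightarrow> 'a \<Rightarrow> 'a multiset \<Rightarrow> nat \<Rightarrow> 'a multiset" where
  "slide x y M b = filter_mset (\<lambda>z. z \<noteq> x \<and> z \<noteq> y) M
     + replicate_mset (count M x + count M y - b) x + replicate_mset b y"

definition fibre :: "'a \<Rightarrow> 'a \<Rightarrow> 'a multiset set \<Rightarrow> 'a multiset \<Rightarrow> nat set" where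
  "fibre x y F M = {b. b \<le> count M x + count M y \<and> slide x y M b \<in> F}"

definition compress :: "'a \<Rightarrow> 'a \<Rightarrow> 'a multiset set \<Rightarrow> 'a multiset set" where
  "compress x y F = {M. count M y < card (fibre x y F M)}"

text \<open>Replacing the exponent of \<open>y\<close> by its rank in the fibre makes compression an
  explicit bijection that never raises this exponent.\<close>

definition compress_map :: "'a \<Rightarrow> 'a \<Rightarrow> 'a multiset set \<Rightarrow> 'a multiset \<Rightarrow> 'a multiset" where
  "compress_map x y F M = slide x y M (card {b \<in> fibre x y F M. b < count M y})"

lemma finite_fibre: "finite (fibre x y F M)"
  by (simp add: fibre_def)

lemma count_slide:
  assumes "x \<noteq> y"
  shows "count (slide x y M b) z =
     (if z = x then count M x + count M y - b else if z = y then b else count M z)"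
  using assms by (auto simp: slide_def)

lemma slide_self: "x \<noteq> y \<Longrightarrow> slide x y M (count M y) = M"
  by (rule multiset_eqI) (simp add: count_slide)

lemma slide_slide: "x \<noteq> y \<Longrightarrow> b \<le> count M x + count M y \<Longrightarrow> slide x y (slide x y M b) c = slide x y M c"
  by (rule multiset_eqI) (simp add: count_slide)

lemma fibre_slide: "x \<noteq> y \<Longrightarrow> b \<le> count M x + count M y \<Longrightarrow> fibre x y F (slide x y M b) = fibre x y F M"
  by (auto simp: fibre_def slide_slide count_slide)

lemma size_slide:
  assumes "x \<noteq> y" "b \<le> count M x + count M y"
  shows "size (slide x y M b) = size M"
proof -
  have "size M = size (slide x y M (count M y))" by (simp add: slide_self assms)
  also have "\<dots> = size (slide x y M b)" using assms(2) by (simp add: slide_def)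
  finally show ?thesis ..
qed

lemma bij_betw_rank:
  fixes B :: "nat set"
  assumes "finite B"
  shows "bij_betw (\<lambda>b. card {c \<in> B. c < b}) B {..<card B}"
proof -
  have less: "card {c \<in> B. c < a} < card {c \<in> B. c < b}" if "a \<in> B" "a < b" for a b
    using assms that by (intro psubset_card_mono) auto
  have inj: "inj_on (\<lambda>b. card {c \<in> B. c < b}) B"
  proof (rule inj_onI)
    fix a b assume "a \<in> B" "b \<in> B" "card {c \<in> B. c < a} = card {c \<in> B. c < b}"
    then show "a = b" using less[of a b] less[of b a] by (cases a b rule: linorder_cases) auto
  qed
  moreover have "(\<lambda>b. card {c \<in> B. c < b}) ` B \<subseteq> {..<card B}"
    using assms by (auto intro!: psubset_card_mono)
  ultimately show ?thesis
    unfolding bij_betw_def using card_image[OF inj]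
    by (intro conjI card_subset_eq) auto
qed

lemma rank_le: "card {c \<in> B. c < (b::nat)} \<le> b"
  using card_mono[of "{..<b}" "{c \<in> B. c < b}"] by auto

lemma mem_fibre_self: "x \<noteq> y \<Longrightarrow> count M y \<in> fibre x y F M \<longleftrightarrow> M \<in> F"
  by (simp add: fibre_def slide_self)

text \<open>Sliding does not change the fibre, and on each fibre the map is the order isomorphism
  onto the initial interval of the same size.\<close>

lemma bij_betw_compress_map:
  assumes "x \<noteq> y"
  shows "bij_betw (compress_map x y F) F (compress x y F)"
proof -
  let ?rank = "\<lambda>B b. card {c \<in> B. c < (b::nat)}"
  have rle: "?rank B (count M y) \<le> count M x + count M y" for B M
    using rank_le[of B "count M y"] by simp
  note bij = bij_betw_rank[OF finite_fibre, of x y F]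
  have fib: "fibre x y F (compress_map x y F M) = fibre x y F M" for M
    unfolding compress_map_def using assms rle by (rule fibre_slide)
  have "inj_on (compress_map x y F) F"
  proof (rule inj_onI)
    fix M M' assume M: "M \<in> F" "M' \<in> F" and eq: "compress_map x y F M = compress_map x y F M'"
    then have B: "fibre x y F M = fibre x y F M'" using fib by metis
    have "count (compress_map x y F M) y = count (compress_map x y F M') y" using eq by simp
    then have "?rank (fibre x y F M) (count M y) = ?rank (fibre x y F M) (count M' y)"
      using assms B by (simp add: compress_map_def count_slide)
    then have c: "count M y = count M' y"
      using bij_betw_imp_inj_on[OF bij[of M]] M assms B
      by (auto simp: inj_on_def mem_fibre_self[symmetric])
    \<comment> \<open>Sliding back to the original exponent of \<open>y\<close> recovers
      \<open>M\<close>.\<close>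
    have "M = slide x y (compress_map x y F M) (count M y)" for M
      unfolding compress_map_def using assms rle by (simp add: slide_slide slide_self)
    then show "M = M'" using c eq by metis
  qed
  moreover have "compress_map x y F M \<in> compress x y F" if "M \<in> F" for M
  proof -
    have "?rank (fibre x y F M) (count M y) < card (fibre x y F M)"
      using bij_betw_imp_surj_on[OF bij[of M]] that assms by (auto simp: mem_fibre_self[symmetric])
    then show ?thesis
      using assms by (simp add: compress_def fib) (simp add: compress_map_def count_slide)
  qed
  moreover have "M \<in> compress_map x y F ` F" if "M \<in> compress x y F" for M
  proof -
    have "count M y \<in> {..<card (fibre x y F M)}" using that by (simp add: compress_def)
    then have "count M y \<in> ?rank (fibre x y F M) ` fibre x y F M"
      using bij_betw_imp_surj_on[OF bij[of M]] by simp
    then obtain b where b: "b \<in> fibre x y F M" "?rank (fibre x y F M) b = count M y"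
      by (elim imageE) simp
    then have b': "slide x y M b \<in> F" "b \<le> count M x + count M y" by (auto simp: fibre_def)
    have "compress_map x y F (slide x y M b) = M"
      using assms b b' by (simp add: compress_map_def fibre_slide count_slide slide_slide slide_self)
    then show ?thesis using b' by (metis imageI)
  qed
  ultimately show ?thesis unfolding bij_betw_def by blast
qed

section \<open>Behaviour of shadows under compression\<close>

lemma slide_add_other:
  "x \<noteq> y \<Longrightarrow> z \<noteq> x \<Longrightarrow> z \<noteq> y \<Longrightarrow> slide x y (add_mset z N) b = add_mset z (slide x y N b)"
  by (rule multiset_eqI) (simp add: count_slide)

lemma slide_add_left:
  "x \<noteq> y \<Longrightarrow> z = x \<or> z = y \<Longrightarrow> b \<le> count N x + count N y \<Longrightarrow>
     slide x y (add_mset z N) b = add_mset x (slide x y N b)"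
  by (rule multiset_eqI) (auto simp: count_slide Suc_diff_le)

lemma slide_add_right:
  "x \<noteq> y \<Longrightarrow> z = x \<or> z = y \<Longrightarrow>
     slide x y (add_mset z N) (Suc b) = add_mset y (slide x y N b)"
  by (rule multiset_eqI) (auto simp: count_slide)

text \<open>For \<open>z\<close> other than \<open>x\<close> and \<open>y\<close>, the fibre of
  \<open>add_mset z N\<close> in \<open>F\<close> embeds into that of \<open>N\<close> in the
  shadow. Otherwise dividing by \<open>x\<close> keeps an exponent and dividing by \<open>y\<close>
  lowers it by one, so the cardinality can drop only if the fibre is a full interval.\<close>

lemma shadow_compress_subset:
  assumes "x \<noteq> y"
  shows "shadow (compress x y F) \<subseteq> compress x y (shadow F)"
proof
  fix N assume "N \<in> shadow (compress x y F)"
  then obtain z where z: "count (add_mset z N) y < card (fibre x y F (add_mset z N))"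
    by (auto simp: shadow_def compress_def)
  let ?B = "fibre x y F (add_mset z N)" and ?B' = "fibre x y (shadow F) N"
  have "count N y < card ?B'"
  proof (cases "z = x \<or> z = y")
    case False
    then have "?B \<subseteq> ?B'"
      using assms by (auto simp: fibre_def shadow_def slide_add_other)
    then have "card ?B \<le> card ?B'" by (intro card_mono finite_fibre)
    then show ?thesis using z False by simp
  next
    case True
    define m where "m = count N x + count N y"
    have Bm: "?B \<subseteq> {..Suc m}" using True assms by (auto simp: fibre_def m_def)
    have low: "b \<in> ?B'" if "b \<in> ?B" "b \<le> m" for b
      using that True assms by (auto simp: fibre_def shadow_def slide_add_left m_def)
    have high: "b \<in> ?B'" if "Suc b \<in> ?B" for b
      using that True assms by (auto simp: fibre_def shadow_def slide_add_right)
    have c: "count N y < card ?B" using z by (simp split: if_splits)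
    show ?thesis
    proof (cases "{..Suc m} \<subseteq> ?B")
      \<comment> \<open>A full fibre may lose one exponent, but the \<open>Suc m\<close> remaining
        ones still outnumber the exponent of \<open>y\<close> in \<open>N\<close>, which is at most
        \<open>m\<close>.\<close>
      case full: True
      then have "{..m} \<subseteq> ?B'" by (auto intro!: low)
      then have "Suc m \<le> card ?B'" using card_mono[OF finite_fibre, of "{..m}"] by force
      then show ?thesis by (simp add: m_def)
    next
      case False
      then obtain a where a: "a \<le> Suc m" "a \<notin> ?B" by auto
      \<comment> \<open>\<open>a\<close> is a gap in the fibre: exponents below it are kept, those
        above it move down by one, and the gap prevents collisions.\<close>
      let ?g = "\<lambda>b. if b < a then b else b - 1"
      have "inj_on ?g ?B"
      proof (rule inj_onI)
        fix b c assume "b \<in> ?B" "c \<in> ?B" "?g b = ?g c"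
        moreover have "b \<noteq> a" "c \<noteq> a" using calculation a by auto
        ultimately show "b = c" by (simp split: if_splits; linarith)
      qed
      moreover have "?g ` ?B \<subseteq> ?B'"
      proof safe
        fix b assume b: "b \<in> ?B"
        show "?g b \<in> ?B'"
        proof (cases "b < a")
          case True then show ?thesis using a b low[of b] by simp
        next
          case False
          then have "0 < b" using a b by (metis gr0I le_0_eq not_less)
          then show ?thesis using False b high[of "b - 1"] by simp
        qed
      qed
      ultimately have "card ?B \<le> card ?B'"
        by (metis card_image card_mono finite_fibre)
      then show ?thesis using c by simp
    qed
  qed
  then show "N \<in> compress x y (shadow F)" by (simp add: compress_def)
qed

lemma compress_multisets_of_size:
  assumes "x \<noteq> y" "x \<in> V" "y \<in> V" "F \<subseteq> multisets_of_size V d"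
  shows "compress x y F \<subseteq> multisets_of_size V d"
proof
  fix M assume "M \<in> compress x y F"
  then have "fibre x y F M \<noteq> {}" by (auto simp: compress_def)
  then obtain b where b: "b \<le> count M x + count M y" "slide x y M b \<in> multisets_of_size V d"
    using assms(4) by (auto simp: fibre_def)
  have "z \<in> V" if "z \<in># M" for z
  proof (cases "z = x \<or> z = y")
    case False
    then have "z \<in># slide x y M b" using that assms(1) by (simp add: slide_def)
    then show ?thesis using b(2) by (auto simp: multisets_of_size_def)
  qed (use assms in auto)
  then show "M \<in> multisets_of_size V d"
    using b size_slide[OF assms(1) b(1)] by (auto simp: multisets_of_size_def)
qed

text \<open>Among the families of the same cardinality whose shadow is not larger, one of least total degree
  outside \<open>x\<close> is fixed by
  all compressions, hence stable.\<close>

lemma stable_rearrangement: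
  assumes "finite V" "x \<in> V" "F \<subseteq> multisets_of_size V (Suc d)"
  obtains G where "G \<subseteq> multisets_of_size V (Suc d)" "shift_stable x G" "card G = card F"
    "card (shadow G) \<le> card (shadow F)"
proof -
  define good where "good G \<longleftrightarrow> G \<subseteq> multisets_of_size V (Suc d) \<and> card G = card F \<and>
      card (shadow G) \<le> card (shadow F)" for G
  define wt where "wt G = (\<Sum>M\<in>G. size M - count M x)" for G
  have "good F" using assms by (simp add: good_def)
  then obtain G where G: "good G" and least: "\<And>G'. good G' \<Longrightarrow> wt G \<le> wt G'"
    using ex_has_least_nat[of good F wt] by blast
  have GV: "G \<subseteq> multisets_of_size V (Suc d)" using G by (simp add: good_def)
  have fin: "finite G" using GV by (rule finite_subset) (use assms in \<open>auto intro: finite_multisets_of_size\<close>)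
  have "add_mset x N \<in> G" if N: "add_mset y N \<in> G" for N y
  proof (cases "x = y")
    case False
    let ?M = "add_mset y N"
    have "y \<in> V" using N GV by (auto simp: multisets_of_size_def)
    have "good (compress x y G)"
    proof -
      have c: "card (compress x y H) = card H" for H
        using bij_betw_same_card[OF bij_betw_compress_map[OF False, of H]] by simp
      have "finite (compress x y (shadow G))"
        by (rule finite_subset[OF compress_multisets_of_size[OF False assms(2) \<open>y \<in> V\<close> shadow_multisets_of_size[OF GV]]])
           (use assms in \<open>auto intro: finite_multisets_of_size\<close>)
      then have "card (shadow (compress x y G)) \<le> card (compress x y (shadow G))"
        by (intro card_mono shadow_compress_subset False)
      then show ?thesis
        using G compress_multisets_of_size[OF False assms(2) \<open>y \<in> V\<close> GV] by (auto simp: good_def c)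
    qed
    from least[OF this]
    have le: "(\<Sum>M\<in>G. size M - count M x) \<le>
        (\<Sum>M\<in>G. size (compress_map x y G M) - count (compress_map x y G M) x)"
      unfolding wt_def
      using sum.reindex_bij_betw[OF bij_betw_compress_map[OF False, of G], of "\<lambda>M. size M - count M x"]
      by simp
    let ?r = "\<lambda>M. card {b \<in> fibre x y G M. b < count M y}"
    have r: "?r M \<le> count M y" for M by (rule rank_le)
    have sz: "size (compress_map x y G M) = size M" for M
      unfolding compress_map_def using False r[of M] by (intro size_slide) auto
    have ct: "count (compress_map x y G M) x = count M x + count M y - ?r M" for M
      unfolding compress_map_def using False by (simp add: count_slide)
    \<comment> \<open>If the exponent of \<open>y\<close> in a member exceeded its rank, compression
      would turn some \<open>y\<close> into \<open>x\<close> and reduce the weight, against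
      minimality.\<close>
    have "?r ?M = count ?M y"
    proof (rule ccontr)
      assume "?r ?M \<noteq> count ?M y"
      then have lt: "?r ?M < count ?M y" using r[of ?M] by linarith
      have "count ?M x + count ?M y \<le> size ?M"
      proof -
        have "replicate_mset (count ?M x) x + replicate_mset (count ?M y) y \<subseteq># ?M"
          using False by (auto simp: subseteq_mset_def)
        from size_mset_mono[OF this] show ?thesis by simp
      qed
      then have "size ?M - (count ?M x + count ?M y - ?r ?M) < size ?M - count ?M x"
        using lt by linarith
      moreover have "size M - (count M x + count M y - ?r M) \<le> size M - count M x" for M
        using r[of M] by linarith
      ultimately have "(\<Sum>M\<in>G. size M - (count M x + count M y - ?r M)) < (\<Sum>M\<in>G. size M - count M x)"
        using fin N by (intro sum_strict_mono_ex1) blast+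
      then show False using le by (simp add: sz ct)
    qed
    \<comment> \<open>The fibre contains all smaller exponents of \<open>y\<close>; lowering the
      exponent by exactly one is the required exchange of one \<open>y\<close> for
      \<open>x\<close>.\<close>
    then have "{b \<in> fibre x y G ?M. b < count ?M y} = {..<count ?M y}"
      by (intro card_subset_eq) auto
    then have "count N y \<in> fibre x y G ?M" by auto
    then have "slide x y ?M (count N y) \<in> G" by (simp add: fibre_def)
    moreover have "slide x y ?M (count N y) = add_mset x N"
      using False by (simp add: slide_add_left slide_self)
    ultimately show ?thesis by simp
  qed (use N in simp)
  then have "shift_stable x G" by (auto simp: shift_stable_def)
  then show ?thesis using that[of G] G by (simp add: good_def)
qed

text \<open>Induction on the variables. A stable rearrangement splits into its \<open>x\<close>-free
  part and a copy of its shadow; Green's bound and the induction hypothesis control the former, and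
  Pascal's rule adds the two up. The coefficients are arbitrary integers because the induction
  lowers them and may leave the shape of an expansion.\<close>

theorem Macaulay_bound:
  fixes k :: "nat \<Rightarrow> int"
  assumes "finite V" "F \<subseteq> multisets_of_size V (Suc d)" "1 \<le> \<delta>"
    "card (shadow F) \<le> (\<Sum>i=\<delta>..d. binom (k i) (int i))"
  shows "card F \<le> (\<Sum>i=\<delta>..d. binom (k i + 1) (int i + 1))"
  using assms
proof (induction V arbitrary: F d \<delta> k rule: finite_induct)
  case empty
  then show ?case by simp
next
  case (insert x V)
  obtain G where G: "G \<subseteq> multisets_of_size (insert x V) (Suc d)" "shift_stable x G" "card G = card F"
    "card (shadow G) \<le> card (shadow F)"
    using stable_rearrangement[OF _ _ insert.prems(1), of x] insert.hyps(1) by auto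
  let ?G0 = "{M \<in> G. x \<notin># M}"
  have finS: "finite (shadow G)" and finG: "finite G"
    using shadow_multisets_of_size[OF G(1)] G(1)
    by (meson finite_insert finite_multisets_of_size finite_subset insert.hyps(1))+
  have le: "card (shadow G) \<le> (\<Sum>i=\<delta>..d. binom (k i) (int i))"
    using G(4) insert.prems(3) by linarith
  have "card (shadow ?G0) \<le> card {M \<in> shadow G. x \<notin># M}"
    using finS by (intro card_mono shadow_free_subset) auto
  also have "\<dots> \<le> (\<Sum>i=\<delta>..d. binom (k i - 1) (int i))"
    using insert.hyps(1) insert.IH shadow_multisets_of_size[OF G(1)] stable_shadow[OF G(2)] insert.prems(2) le
    by (rule Green_stable)
  finally have "card ?G0 \<le> (\<Sum>i=\<delta>..d. binom (k i - 1 + 1) (int i + 1))"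
    using G(1) insert.prems(2) by (intro insert.IH) (auto simp: multisets_of_size_def)
  then have "card G \<le> (\<Sum>i=\<delta>..d. binom (k i) (int i + 1)) + (\<Sum>i=\<delta>..d. binom (k i) (int i))"
    using card_stable[OF finG G(2)] le by simp
  also have "\<dots> = (\<Sum>i=\<delta>..d. binom (k i + 1) (int i + 1))"
  proof -
    have "binom (k i + 1) (int i + 1) = binom (k i) (int i + 1) + binom (k i) (int i)" for i
      using binom_Pascal[of "int i + 1" "k i + 1"] by simp
    then show ?thesis by (simp add: sum.distrib)
  qed
  finally show ?case using G(3) by simp
qed

section \<open>Injectivity of multiplication by the sum of the variables\<close>

text \<open>With \<open>f\<close> read as the coefficients of a polynomial, this is the coefficient
  of \<open>M\<close> in its product with the sum of the variables.\<close>

definition up :: "('a multiset \<Rightarrow> real) \<Rightarrow> 'a multiset \<Rightarrow> real" where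
  "up f M = (\<Sum>y\<in>set_mset M. f (M - {#y#}))"

text \<open>With these weights \<open>up\<close> and \<open>down G\<close> generate an action of $\mathfrak{sl}_2$ on the divisors of \<open>G\<close>.\<close>

definition down :: "'a multiset \<Rightarrow> ('a multiset \<Rightarrow> real) \<Rightarrow> 'a multiset \<Rightarrow> real" where
  "down G f M = (\<Sum>y\<in>set_mset G.
     (real (count M y) + 1) * (real (count G y) - real (count M y)) * f (add_mset y M))"

lemma size_eq_sum_count:
  assumes "finite V" "set_mset M \<subseteq> V"
  shows "real (size M) = (\<Sum>y\<in>V. real (count M y))"
proof -
  have "size M = (\<Sum>y\<in>set_mset M. count M y)" by (rule size_multiset_overloaded_eq)
  also have "\<dots> = (\<Sum>y\<in>V. count M y)"
    using assms by (intro sum.mono_neutral_left) (auto simp: not_in_iff)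
  finally show ?thesis by simp
qed

text \<open>Terms with distinct variables occur in both compositions and cancel. For equal variables
  the weight at exponent \<open>a\<close> minus the weight at \<open>a - 1\<close> is
  \<open>count G y - 2 * a\<close>, and summation over \<open>y\<close> gives the degrees.\<close>

lemma down_up_commutator:
  assumes "set_mset M \<subseteq> set_mset G"
  shows "down G (up f) M = up (down G f) M + (real (size G) - 2 * real (size M)) * f M"
proof -
  let ?V = "set_mset G" and ?W = "set_mset M"
  define w where "w N y = (real (count N y) + 1) * (real (count G y) - real (count N y))" for N y
  define T where "T y z = (if z = y then 0 else w M y * f (add_mset y (M - {#z#})))" for y z
  \<comment> \<open>The weight of \<open>z\<close> at \<open>M - {#z#}\<close>; it vanishes if
    \<open>z\<close> does not divide \<open>M\<close>, which lets the sum extend to all variables of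
    \<open>G\<close>.\<close>
  define u where "u z = real (count M z) * (real (count G z) - real (count M z) + 1)" for z
  have "w M y * up f (add_mset y M) = w M y * f M + (\<Sum>z\<in>?W. T y z)" for y
  proof -
    have "up f (add_mset y M) = f M + (\<Sum>z\<in>?W - {y}. f (add_mset y M - {#z#}))"
      unfolding up_def by (simp add: sum.insert_remove)
    also have "(\<Sum>z\<in>?W - {y}. f (add_mset y M - {#z#})) = (\<Sum>z\<in>?W - {y}. f (add_mset y (M - {#z#})))"
      by (intro sum.cong) auto
    finally have "w M y * up f (add_mset y M) = w M y * (f M + (\<Sum>z\<in>?W - {y}. f (add_mset y (M - {#z#}))))"
      by simp
    also have "\<dots> = w M y * f M + (\<Sum>z\<in>?W - {y}. T y z)"
      unfolding distrib_left sum_distrib_left by (intro arg_cong2[of _ _ _ _ "(+)"] sum.cong) (auto simp: T_def)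
    also have "(\<Sum>z\<in>?W - {y}. T y z) = (\<Sum>z\<in>?W. T y z)"
      by (rule sum.mono_neutral_left) (auto simp: T_def)
    finally show ?thesis .
  qed
  then have L: "down G (up f) M = (\<Sum>y\<in>?V. w M y) * f M + (\<Sum>y\<in>?V. \<Sum>z\<in>?W. T y z)"
    unfolding down_def w_def[symmetric] by (simp add: sum.distrib sum_distrib_right)
  have "down G f (M - {#z#}) = u z * f M + (\<Sum>y\<in>?V. T y z)" if z: "z \<in># M" for z
  proof -
    have zV: "z \<in> ?V" using z assms by auto
    have "down G f (M - {#z#}) = w (M - {#z#}) z * f M + (\<Sum>y\<in>?V - {z}. w (M - {#z#}) y * f (add_mset y (M - {#z#})))"
      unfolding down_def w_def[symmetric] using zV z by (subst sum.remove[of _ z]) auto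
    also have "w (M - {#z#}) z = u z"
      using z by (simp add: w_def u_def of_nat_diff Suc_le_eq)
    also have "(\<Sum>y\<in>?V - {z}. w (M - {#z#}) y * f (add_mset y (M - {#z#}))) = (\<Sum>y\<in>?V - {z}. T y z)"
      by (intro sum.cong) (auto simp: T_def w_def)
    also have "\<dots> = (\<Sum>y\<in>?V. T y z)"
      by (rule sum.mono_neutral_left) (auto simp: T_def)
    finally show ?thesis .
  qed
  then have "up (down G f) M = (\<Sum>z\<in>?W. u z) * f M + (\<Sum>z\<in>?W. \<Sum>y\<in>?V. T y z)"
    unfolding up_def by (simp add: sum.distrib sum_distrib_right)
  also have "(\<Sum>z\<in>?W. u z) = (\<Sum>z\<in>?V. u z)"
    using assms by (intro sum.mono_neutral_left) (auto simp: u_def not_in_iff)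
  also have "(\<Sum>z\<in>?W. \<Sum>y\<in>?V. T y z) = (\<Sum>y\<in>?V. \<Sum>z\<in>?W. T y z)"
    by (rule sum.swap)
  finally have R: "up (down G f) M = (\<Sum>z\<in>?V. u z) * f M + (\<Sum>y\<in>?V. \<Sum>z\<in>?W. T y z)" .
  have "(\<Sum>y\<in>?V. w M y) - (\<Sum>y\<in>?V. u y) = (\<Sum>y\<in>?V. real (count G y) - 2 * real (count M y))"
    unfolding sum_subtractf[symmetric] by (intro sum.cong) (auto simp: w_def u_def algebra_simps)
  also have "\<dots> = real (size G) - 2 * real (size M)"
    using size_eq_sum_count[of ?V G] size_eq_sum_count[of ?V M] assms
    by (simp add: sum_subtractf sum_distrib_left)
  finally have w: "(\<Sum>y\<in>?V. w M y) = (\<Sum>y\<in>?V. u y) + (real (size G) - 2 * real (size M))" by simp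
  show ?thesis unfolding L R w by (simp add: algebra_simps)
qed

text \<open>The factor \<open>count G y - count M y\<close> vanishes exactly when
  \<open>add_mset y M\<close> stops dividing \<open>G\<close>.\<close>

lemma down_cong:
  assumes "M \<subseteq># G" "\<And>N. N \<subseteq># G \<Longrightarrow> size N = Suc (size M) \<Longrightarrow> f N = g N"
  shows "down G f M = down G g M"
  unfolding down_def
proof (rule sum.cong)
  fix y assume "y \<in># G"
  show "(real (count M y) + 1) * (real (count G y) - real (count M y)) * f (add_mset y M) =
        (real (count M y) + 1) * (real (count G y) - real (count M y)) * g (add_mset y M)"
  proof (cases "count M y < count G y")
    case True
    then have "add_mset y M \<subseteq># G"
      using assms(1) by (auto simp: subseteq_mset_def Suc_le_eq)
    then show ?thesis using assms(2) by simp
  next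
    case False
    then have "count M y = count G y" using assms(1) by (meson mset_subset_eq_count order_antisym not_less)
    then show ?thesis by simp
  qed
qed simp

text \<open>The composite \<open>down G\<close> after \<open>up\<close> has no eigenvalue
  \<open>- c \<le> 0\<close> below the middle: by the commutator, \<open>down G f\<close> is an
  eigenvector one degree lower with a still smaller eigenvalue, so it vanishes by induction, and
  then so does \<open>f\<close>.\<close>

lemma up_eigenvector_zero:
  assumes "2 * s < size G" "0 \<le> c"
    and "\<And>M. M \<subseteq># G \<Longrightarrow> size M = s \<Longrightarrow> down G (up f) M = - c * f M"
    and "M \<subseteq># G" "size M = s"
  shows "f M = 0"
  using assms
proof (induction s arbitrary: f c M)
  case 0
  then have "M = {#}" by simp
  moreover have "down G (up f) {#} = up (down G f) {#} + real (size G) * f {#}"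
    using down_up_commutator[of "{#}" G f] by simp
  moreover have "down G (up f) {#} = - c * f {#}" using 0 by simp
  ultimately have "(c + real (size G)) * f M = 0" by (simp add: up_def algebra_simps)
  moreover have "c + real (size G) > 0" using 0 by simp
  ultimately show ?case by simp
next
  case (Suc s)
  \<comment> \<open>Moving the commutator term across turns \<open>- c\<close> into the eigenvalue
    \<open>- c'\<close> of the reverse composition.\<close>
  define c' where "c' = c + (real (size G) - 2 * real (Suc s))"
  have c': "0 < c'" using Suc.prems(1,2) by (simp add: c'_def)
  have ud: "up (down G f) N = - c' * f N" if N: "N \<subseteq># G" "size N = Suc s" for N
    using Suc.prems(3)[OF N] down_up_commutator[OF set_mset_mono[OF N(1)], of f] N(2)
    by (simp add: c'_def algebra_simps)
  have "down G (up (down G f)) N = - c' * down G f N" if N: "N \<subseteq># G" "size N = s" for N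
  proof -
    have "down G (up (down G f)) N = down G (\<lambda>N. - c' * f N) N"
      using N ud by (intro down_cong) auto
    also have "\<dots> = - c' * down G f N"
      unfolding down_def sum_distrib_left by (intro sum.cong) auto
    finally show ?thesis .
  qed
  then have "down G f N = 0" if "N \<subseteq># G" "size N = s" for N
    using Suc.IH[of c' "down G f" N] Suc.prems(1) c' that by simp
  moreover have "M - {#y#} \<subseteq># G" for y using Suc.prems(4) by (meson diff_subset_eq_self subset_mset.order_trans)
  ultimately have "up (down G f) M = 0"
    unfolding up_def using Suc.prems(5) by (intro sum.neutral) (auto simp: size_Diff_singleton)
  then show ?case using ud[OF Suc.prems(4,5)] c' by simp
qed

text \<open>A function killed by \<open>up\<close> is an eigenvector for
  \<open>c = 0\<close>.\<close>

lemma up_injective: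
  assumes "2 * s < size G" "\<And>M. M \<subseteq># G \<Longrightarrow> size M = Suc s \<Longrightarrow> up f M = 0" "M \<subseteq># G" "size M = s"
  shows "f M = 0"
proof (rule up_eigenvector_zero[OF assms(1) order_refl _ assms(3,4)])
  fix N assume N: "N \<subseteq># G" "size N = s"
  have "down G (up f) N = down G (\<lambda>_. 0) N"
    using N assms(2) by (intro down_cong) auto
  then show "down G (up f) N = - 0 * f N" by (simp add: down_def)
qed

section \<open>From the divisors of one monomial to pure order ideals\<close>

lemma maximal_monomial_above:
  assumes "finite X" "M \<in> X"
  obtains G where "maximal_monomial X G" "M \<subseteq># G"
proof -
  let ?A = "{N \<in> X. M \<subseteq># N}"
  have A: "finite ?A" "?A \<noteq> {}" using assms by auto
  then have "Max (size ` ?A) \<in> size ` ?A" by (intro Max_in) auto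
  then obtain G where G: "G \<in> ?A" "Max (size ` ?A) = size G" by (elim imageE) simp
  have "maximal_monomial X G"
    unfolding maximal_monomial_def
  proof (intro conjI ballI impI)
    fix N assume N: "N \<in> X" "G \<subseteq># N"
    then have "N \<in> ?A" using G(1) by auto
    then have "size N \<le> size G" unfolding G(2)[symmetric] using A(1) by (intro Max_ge) auto
    then show "N = G"
      using N(2) mset_subset_size[of G N] by (auto simp: subset_mset.le_less)
  qed (use G in simp)
  then show ?thesis using that G(1) by blast
qed

text \<open>By purity \<open>N\<close> divides a monomial of degree \<open>E\<close> in
  \<open>X\<close>. Its divisors lie in \<open>X\<close>, and \<open>up f\<close> at such a divisor
  involves only further divisors, so the case of a single monomial applies.\<close>

lemma pure_up_injective:
  assumes "pure_order_ideal E X" "2 * s < E"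
    "\<And>M. M \<in> X \<Longrightarrow> size M = Suc s \<Longrightarrow> up f M = 0" "N \<in> X" "size N = s"
  shows "f N = 0"
proof -
  have X: "finite X" "\<And>M N. M \<in> X \<Longrightarrow> N \<subseteq># M \<Longrightarrow> N \<in> X"
    using assms(1) by (auto simp: pure_order_ideal_def monomial_order_ideal_def)
  obtain G where G: "maximal_monomial X G" "N \<subseteq># G"
    using maximal_monomial_above[OF X(1) assms(4)] .
  then have "size G = E" "G \<in> X"
    using assms(1) by (auto simp: pure_order_ideal_def maximal_monomial_def)
  then show ?thesis
    using up_injective[of s G f N] assms X(2) G(2) by blast
qed

section \<open>Leading monomials of the inverse system\<close>

lemma homogeneous_system_nontrivial:
  fixes m :: "'b \<Rightarrow> 'a \<Rightarrow> real"
  assumes "finite B" "finite A" "card B < card A"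
  shows "\<exists>f. (\<exists>a\<in>A. f a \<noteq> 0) \<and> (\<forall>b\<in>B. (\<Sum>a\<in>A. m b a * f a) = 0)"
  using assms
proof (induction B arbitrary: A m rule: finite_induct)
  case empty
  then have "A \<noteq> {}" by auto
  then show ?case by (intro exI[of _ "\<lambda>_. 1"]) auto
next
  case (insert b B)
  show ?case
  proof (cases "\<forall>a\<in>A. m b a = 0")
    case True
    moreover obtain f where "\<exists>a\<in>A. f a \<noteq> 0" "\<forall>b\<in>B. (\<Sum>a\<in>A. m b a * f a) = 0"
      using insert.IH[of A m] insert.prems insert.hyps by auto
    ultimately show ?thesis by (intro exI[of _ f]) auto
  next
    case False
    then obtain a0 where a0: "a0 \<in> A" "m b a0 \<noteq> 0" by blast
    let ?A = "A - {a0}"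
    have "card B < card ?A" using insert.prems insert.hyps a0 by auto
    then obtain f where f: "\<exists>a\<in>?A. f a \<noteq> 0"
      "\<And>c. c \<in> B \<Longrightarrow> (\<Sum>a\<in>?A. (m c a - m c a0 * m b a / m b a0) * f a) = 0"
      using insert.IH[of ?A "\<lambda>c a. m c a - m c a0 * m b a / m b a0"] insert.prems by auto
    \<comment> \<open>Elimination with pivot \<open>m b a0\<close>: the value at \<open>a0\<close>
      solves equation \<open>b\<close>, and the modified coefficients carry the other equations
      over.\<close>
    define g where "g = f(a0 := - (\<Sum>a\<in>?A. m b a * f a) / m b a0)"
    have g: "(\<Sum>a\<in>A. m c a * g a) = (\<Sum>a\<in>?A. m c a * f a) - m c a0 * (\<Sum>a\<in>?A. m b a * f a) / m b a0" for c
    proof -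
      have "(\<Sum>a\<in>A. m c a * g a) = m c a0 * g a0 + (\<Sum>a\<in>?A. m c a * g a)"
        using insert.prems a0 by (intro sum.remove) auto
      also have "(\<Sum>a\<in>?A. m c a * g a) = (\<Sum>a\<in>?A. m c a * f a)"
        by (intro sum.cong) (auto simp: g_def)
      finally show ?thesis by (simp add: g_def)
    qed
    have "(\<Sum>a\<in>A. m c a * g a) = (\<Sum>a\<in>?A. (m c a - m c a0 * m b a / m b a0) * f a)" for c
      unfolding g by (simp add: left_diff_distrib sum_subtractf sum_distrib_left sum_divide_distrib mult.assoc)
    then have "(\<Sum>a\<in>A. m c a * g a) = 0" if "c \<in> B" for c using f(2) that by simp
    moreover have "(\<Sum>a\<in>A. m b a * g a) = 0" unfolding g using a0 by simp
    moreover have "\<exists>a\<in>A. g a \<noteq> 0" using f(1) by (auto simp: g_def)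
    ultimately show ?thesis by (intro exI[of _ g]) auto
  qed
qed

text \<open>Rank-nullity with the dimension of the kernel counted by leading positions; the
  assumption \<open>rows\<close> says that the rows are linearly independent.\<close>

lemma card_leading_positions:
  fixes m :: "'t \<Rightarrow> 's :: linorder \<Rightarrow> real"
  assumes "finite S" "finite T"
    and rows: "\<And>c. (\<And>s. s \<in> S \<Longrightarrow> (\<Sum>t\<in>T. m t s * c t) = 0) \<Longrightarrow> (\<And>t. t \<in> T \<Longrightarrow> c t = 0)"
  shows "card {s \<in> S. \<exists>f. (\<forall>t\<in>T. (\<Sum>s\<in>S. m t s * f s) = 0) \<and> f s \<noteq> 0 \<and> (\<forall>s'\<in>S. s < s' \<longrightarrow> f s' = 0)}
           + card T = card S" (is "card ?L + _ = _")
proof -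
  define L where "L = ?L"
  have L: "s \<in> L \<longleftrightarrow> s \<in> S \<and> (\<exists>f. (\<forall>t\<in>T. (\<Sum>s\<in>S. m t s * f s) = 0) \<and> f s \<noteq> 0 \<and>
      (\<forall>s'\<in>S. s < s' \<longrightarrow> f s' = 0))" for s
    by (simp add: L_def)
  let ?N = "S - L"
  have fin: "finite ?N" using assms(1) by simp
  have "card ?N \<le> card T"
  proof (rule ccontr)
    assume "\<not> card ?N \<le> card T"
    then obtain f where f: "\<exists>s\<in>?N. f s \<noteq> 0" "\<And>t. t \<in> T \<Longrightarrow> (\<Sum>s\<in>?N. m t s * f s) = 0"
      using homogeneous_system_nontrivial[of T ?N m] assms(2) fin by (metis not_le)
    \<comment> \<open>A nonzero solution supported off the leading positions; its own largest
      position contradicts this.\<close>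
    define g where "g s = (if s \<in> ?N then f s else 0)" for s
    have g0: "(\<Sum>s\<in>S. m t s * g s) = 0" if "t \<in> T" for t
    proof -
      have "(\<Sum>s\<in>S. m t s * g s) = (\<Sum>s\<in>?N. m t s * g s)"
        using assms by (intro sum.mono_neutral_right) (auto simp: g_def)
      also have "\<dots> = (\<Sum>s\<in>?N. m t s * f s)" by (intro sum.cong) (auto simp: g_def)
      finally show ?thesis using f(2) that by simp
    qed
    let ?P = "{s \<in> ?N. f s \<noteq> 0}"
    have P: "finite ?P" "?P \<noteq> {}" using f(1) assms(1) by auto
    then have a: "Max ?P \<in> ?P" by (rule Max_in)
    then have "Max ?P \<notin> L" "Max ?P \<in> S" "g (Max ?P) \<noteq> 0" by (auto simp: g_def)
    moreover have "g s = 0" if "s \<in> S" "Max ?P < s" for s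
    proof (rule ccontr)
      assume "g s \<noteq> 0"
      then have "s \<in> ?P" by (auto simp: g_def split: if_splits)
      then show False using Max_ge[OF P(1), of s] that by simp
    qed
    ultimately show False using g0 unfolding L by blast
  qed
  moreover have "card T \<le> card ?N"
  proof (rule ccontr)
    assume "\<not> card T \<le> card ?N"
    then obtain c where c: "\<exists>t\<in>T. c t \<noteq> 0" "\<And>s. s \<in> ?N \<Longrightarrow> (\<Sum>t\<in>T. m t s * c t) = 0"
      using homogeneous_system_nontrivial[of ?N T "\<lambda>s t. m t s"] assms(2) fin by (metis not_le)
    \<comment> \<open>A nontrivial combination of rows that vanishes off the leading positions, so
      its smallest nonzero position \<open>?a\<close> is the leading position of some solution
      \<open>f\<close>. They overlap only at \<open>?a\<close>, yet their pairing must be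
      zero.\<close>
    define \<phi> where "\<phi> s = (\<Sum>t\<in>T. m t s * c t)" for s
    let ?P = "{s \<in> S. \<phi> s \<noteq> 0}"
    have P: "finite ?P" "?P \<noteq> {}" using c(1) assms(1) rows[of c] by (auto simp: \<phi>_def)
    let ?a = "Min ?P"
    have a: "?a \<in> S" "\<phi> ?a \<noteq> 0" using Min_in[OF P] by auto
    have low: "\<phi> s = 0" if "s \<in> S" "s < ?a" for s
      using Min_le[OF P(1), of s] that by (metis (mono_tags, lifting) mem_Collect_eq not_le)
    have "?a \<in> L" using a c(2)[of ?a] by (auto simp: \<phi>_def)
    then obtain f where f: "\<And>t. t \<in> T \<Longrightarrow> (\<Sum>s\<in>S. m t s * f s) = 0" "f ?a \<noteq> 0"
      "\<And>s. s \<in> S \<Longrightarrow> ?a < s \<Longrightarrow> f s = 0" unfolding L by blast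
    have "0 = (\<Sum>t\<in>T. c t * (\<Sum>s\<in>S. m t s * f s))" using f(1) by simp
    also have "\<dots> = (\<Sum>s\<in>S. \<phi> s * f s)"
      unfolding sum_distrib_left \<phi>_def sum_distrib_right by (subst sum.swap) (simp add: mult_ac)
    also have "\<dots> = \<phi> ?a * f ?a + (\<Sum>s\<in>S - {?a}. \<phi> s * f s)"
      using a assms by (intro sum.remove) auto
    also have "(\<Sum>s\<in>S - {?a}. \<phi> s * f s) = 0"
    proof (rule sum.neutral, rule ballI)
      fix s assume "s \<in> S - {?a}"
      then show "\<phi> s * f s = 0" using low[of s] f(3)[of s] by (cases s ?a rule: linorder_cases) auto
    qed
    finally show False using a f(2) by simp
  qed
  moreover have "card ?N = card S - card L" "card L \<le> card S"
    using assms(1) by (auto simp: L intro!: card_Diff_subset card_mono finite_subset[of L S])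
  ultimately show ?thesis unfolding L_def[symmetric] by linarith
qed

definition variables :: "'a multiset set \<Rightarrow> 'a set" where
  "variables X = (\<Union>M\<in>X. set_mset M)"

text \<open>The degree \<open>i\<close> part of the Macaulay inverse system of \<open>A/\<ell>A\<close>, where \<open>A\<close> is the monomial algebra
  with basis \<open>X\<close> and \<open>\<ell>\<close> is the sum of the variables. It is closed under contraction by variables,
  which is compatible with the multiset order; therefore its leading monomials form an order ideal.\<close>

definition inverse_system :: "'a multiset set \<Rightarrow> nat \<Rightarrow> ('a multiset \<Rightarrow> real) set" where
  "inverse_system X i = {f. (\<forall>M. f M \<noteq> 0 \<longrightarrow> M \<in> X \<and> size M = i) \<and>
     (\<forall>N. Suc (size N) = i \<longrightarrow> (\<Sum>y\<in>variables X. f (add_mset y N)) = 0)}"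

definition leading :: "'a :: linorder multiset set \<Rightarrow> nat \<Rightarrow> 'a multiset set" where
  "leading X i = {M. \<exists>f\<in>inverse_system X i. f M \<noteq> 0 \<and> (\<forall>M'. M < M' \<longrightarrow> f M' = 0)}"

lemma leading_subset: "leading X i \<subseteq> {M \<in> X. size M = i}"
  by (auto simp: leading_def inverse_system_def)

lemma shadow_leading:
  assumes "monomial_order_ideal X"
  shows "shadow (leading X (Suc i)) \<subseteq> leading X i"
proof
  fix N assume "N \<in> shadow (leading X (Suc i))"
  then obtain y f where f: "f \<in> inverse_system X (Suc i)" "f (add_mset y N) \<noteq> 0"
    "\<And>M'. add_mset y N < M' \<Longrightarrow> f M' = 0"
    by (auto simp: shadow_def leading_def)
  \<comment> \<open>Contraction of \<open>f\<close> by \<open>y\<close>. Multiplication by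
    \<open>y\<close> is strictly monotone in the multiset order, so \<open>N\<close> is leading in
    \<open>g\<close>.\<close>
  define g where "g M = f (add_mset y M)" for M
  have "g M \<noteq> 0 \<Longrightarrow> M \<in> X \<and> size M = i" for M
  proof -
    assume "g M \<noteq> 0"
    then have "add_mset y M \<in> X" "size M = i" using f(1) by (auto simp: g_def inverse_system_def)
    moreover have "M \<subseteq># add_mset y M" by simp
    ultimately show ?thesis using assms unfolding monomial_order_ideal_def by blast
  qed
  moreover have "(\<Sum>z\<in>variables X. g (add_mset z M)) = 0" if "Suc (size M) = i" for M
  proof -
    have "(\<Sum>z\<in>variables X. f (add_mset z (add_mset y M))) = 0"
      using f(1) that by (auto simp: inverse_system_def)
    then show ?thesis by (simp add: g_def add_mset_commute)
  qed
  ultimately have "g \<in> inverse_system X i" by (auto simp: inverse_system_def)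
  moreover have "g M' = 0" if "N < M'" for M'
    unfolding g_def using that by (intro f(3)) simp
  moreover have "g N \<noteq> 0" using f(2) by (simp add: g_def)
  ultimately show "N \<in> leading X i" by (auto simp: leading_def)
qed

lemma subset_mset_Suc_size:
  assumes "N \<subseteq># M" "size M = Suc (size N)"
  obtains y where "M = add_mset y N"
proof -
  have "size (M - N) = 1" using assms by (simp add: size_Diff_submset)
  then obtain y where "M - N = {#y#}" using size_1_singleton_mset by blast
  then have "M = add_mset y N" using assms(1) by (metis add_mset_add_single subset_mset.add_diff_inverse)
  then show ?thesis using that by blast
qed

text \<open>Rank-nullity for the divisibility matrix between degrees \<open>i\<close> and
  \<open>Suc i\<close>: its kernel is the inverse system, its row combinations are the values of
  \<open>up\<close>, and its rows are independent by injectivity below the middle degree.\<close>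

lemma card_leading:
  fixes X :: "'a :: linorder multiset set"
  assumes "pure_order_ideal E X" "2 * i < E"
  shows "card (leading X (Suc i)) + card {M \<in> X. size M = i} = card {M \<in> X. size M = Suc i}"
proof -
  let ?S = "{M \<in> X. size M = Suc i}" and ?T = "{M \<in> X. size M = i}"
  define m :: "'a multiset \<Rightarrow> 'a multiset \<Rightarrow> real" where "m N M = (if N \<subseteq># M then 1 else 0)" for N M
  have X: "finite X" "\<And>M N. M \<in> X \<Longrightarrow> N \<subseteq># M \<Longrightarrow> N \<in> X"
    using assms(1) by (auto simp: pure_order_ideal_def monomial_order_ideal_def)
  have fin: "finite ?S" "finite ?T" using X(1) by auto
  have finV: "finite (variables X)" using X(1) by (auto simp: variables_def)
  have row: "(\<Sum>N\<in>?T. m N M * c N) = up c M" if M: "M \<in> ?S" for M c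
  proof -
    have "(\<Sum>N\<in>?T. m N M * c N) = (\<Sum>N\<in>{N \<in> ?T. N \<subseteq># M}. c N)"
      using fin by (intro sum.mono_neutral_cong_right) (auto simp: m_def)
    also have "{N \<in> ?T. N \<subseteq># M} = (\<lambda>y. M - {#y#}) ` set_mset M"
    proof (intro equalityI subsetI)
      fix N assume "N \<in> {N \<in> ?T. N \<subseteq># M}"
      then obtain y where "M = add_mset y N" using M subset_mset_Suc_size[of N M] by auto
      then show "N \<in> (\<lambda>y. M - {#y#}) ` set_mset M" by force
    next
      fix N assume "N \<in> (\<lambda>y. M - {#y#}) ` set_mset M"
      then obtain y where y: "y \<in># M" "N = M - {#y#}" by blast
      then have "N \<subseteq># M" "size N = i" using M by (auto simp: size_Diff_singleton)
      then show "N \<in> {N \<in> ?T. N \<subseteq># M}" using M X(2) by blast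
    qed
    also have "(\<Sum>N\<in>(\<lambda>y. M - {#y#}) ` set_mset M. c N) = up c M"
    proof -
      have "inj_on (\<lambda>y. M - {#y#}) (set_mset M)"
      proof (rule inj_onI, rule ccontr)
        fix y z assume y: "y \<in># M" and eq: "M - {#y#} = M - {#z#}" and ne: "y \<noteq> z"
        have "count M y - 1 = count M y"
          using arg_cong[OF eq, of "\<lambda>A. count A y"] ne by simp
        moreover have "0 < count M y" using y by simp
        ultimately show False by linarith
      qed
      from sum.reindex[OF this, of c] show ?thesis by (simp add: up_def)
    qed
    finally show ?thesis .
  qed
  have col: "(\<Sum>y\<in>variables X. f (add_mset y N)) = (\<Sum>M\<in>?S. m N M * f M)"
    if supp: "\<And>M. f M \<noteq> 0 \<Longrightarrow> M \<in> ?S" and N: "size N = i" for f N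
  proof -
    have "(\<Sum>y\<in>variables X. f (add_mset y N)) = (\<Sum>M\<in>(\<lambda>y. add_mset y N) ` variables X. f M)"
      using sum.reindex[of "\<lambda>y. add_mset y N" "variables X" f] by (simp add: inj_on_def)
    also have "\<dots> = (\<Sum>M\<in>{M \<in> ?S. N \<subseteq># M}. f M)"
    proof (rule sum.mono_neutral_right)
      show "{M \<in> ?S. N \<subseteq># M} \<subseteq> (\<lambda>y. add_mset y N) ` variables X"
      proof
        fix M assume M: "M \<in> {M \<in> ?S. N \<subseteq># M}"
        then obtain y where y: "M = add_mset y N" using subset_mset_Suc_size[of N M] N by auto
        then have "M \<in> X" "y \<in># M" using M by auto
        then have "y \<in> variables X" unfolding variables_def by (rule UN_I)
        then show "M \<in> (\<lambda>y. add_mset y N) ` variables X" using y by blast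
      qed
      show "\<forall>M\<in>(\<lambda>y. add_mset y N) ` variables X - {M \<in> ?S. N \<subseteq># M}. f M = 0"
      proof (intro ballI, rule ccontr)
        fix M assume M: "M \<in> (\<lambda>y. add_mset y N) ` variables X - {M \<in> ?S. N \<subseteq># M}" and "f M \<noteq> 0"
        then have "M \<in> ?S" by (intro supp)
        moreover have "N \<subseteq># M" using M by auto
        ultimately show False using M by blast
      qed
    qed (use finV in simp)
    also have "\<dots> = (\<Sum>M\<in>?S. m N M * f M)"
      using fin by (intro sum.mono_neutral_cong_left) (auto simp: m_def)
    finally show ?thesis .
  qed
  have "leading X (Suc i) =
      {M \<in> ?S. \<exists>f. (\<forall>N\<in>?T. (\<Sum>M\<in>?S. m N M * f M) = 0) \<and> f M \<noteq> 0 \<and> (\<forall>M'\<in>?S. M < M' \<longrightarrow> f M' = 0)}" (is "_ = ?L")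
  proof
    show "leading X (Suc i) \<subseteq> ?L"
    proof
      fix M assume M: "M \<in> leading X (Suc i)"
      then obtain f where f: "f \<in> inverse_system X (Suc i)" "f M \<noteq> 0" "\<And>M'. M < M' \<Longrightarrow> f M' = 0"
        by (auto simp: leading_def)
      have supp: "M \<in> ?S" if "f M \<noteq> 0" for M using f(1) that by (auto simp: inverse_system_def)
      have "(\<Sum>M\<in>?S. m N M * f M) = 0" if "N \<in> ?T" for N
      proof -
        have "(\<Sum>y\<in>variables X. f (add_mset y N)) = (\<Sum>M\<in>?S. m N M * f M)"
          using that by (intro col supp) auto
        then show ?thesis using f(1) that by (auto simp: inverse_system_def)
      qed
      then show "M \<in> ?L" using f supp[OF f(2)] by blast
    qed
    show "?L \<subseteq> leading X (Suc i)"
    proof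
      fix M assume "M \<in> ?L"
      then obtain f where M: "M \<in> ?S" and f: "\<And>N. N \<in> ?T \<Longrightarrow> (\<Sum>M\<in>?S. m N M * f M) = 0" "f M \<noteq> 0"
        "\<And>M'. M' \<in> ?S \<Longrightarrow> M < M' \<Longrightarrow> f M' = 0" by blast
      define g where "g M = (if M \<in> ?S then f M else 0)" for M
      have supp: "M \<in> ?S" if "g M \<noteq> 0" for M using that by (auto simp: g_def split: if_splits)
      have "(\<Sum>y\<in>variables X. g (add_mset y N)) = 0" if N: "Suc (size N) = Suc i" for N
      \<comment> \<open>The inverse system has an equation for every \<open>N\<close> of degree
        \<open>i\<close>, the matrix only for those in \<open>X\<close>; for other \<open>N\<close>
        no multiple lies in \<open>X\<close> and the equation is trivial.\<close>
      proof (cases "N \<in> X")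
        case True
        have "(\<Sum>M\<in>?S. m N M * g M) = (\<Sum>M\<in>?S. m N M * f M)"
          by (intro sum.cong) (auto simp: g_def)
        moreover have "(\<Sum>y\<in>variables X. g (add_mset y N)) = (\<Sum>M\<in>?S. m N M * g M)"
          using N by (intro col supp) auto
        ultimately show ?thesis using f(1)[of N] True N by simp
      next
        case False
        have "add_mset y N \<notin> X" for y using X(2)[of "add_mset y N" N] False by auto
        then show ?thesis by (simp add: g_def)
      qed
      then have "g \<in> inverse_system X (Suc i)" using supp by (auto simp: inverse_system_def)
      moreover have "g M \<noteq> 0" "\<forall>M'. M < M' \<longrightarrow> g M' = 0" using M f by (auto simp: g_def)
      ultimately show "M \<in> leading X (Suc i)" by (auto simp: leading_def)
    qed
  qed
  moreover have "card ?L + card ?T = card ?S"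
  proof (rule card_leading_positions[OF fin])
    fix c N assume c: "\<And>M. M \<in> ?S \<Longrightarrow> (\<Sum>N\<in>?T. m N M * c N) = 0" and N: "N \<in> ?T"
    show "c N = 0"
      using pure_up_injective[OF assms, of c N] c row N by auto
  qed
  ultimately show ?thesis by simp
qed

section \<open>Initial segments in the multiset order\<close>

definition initial_segment :: "nat \<Rightarrow> 'a :: linorder multiset set \<Rightarrow> bool" where
  "initial_segment d I \<longleftrightarrow> finite I \<and> (\<forall>M\<in>I. size M = d) \<and>
     (\<forall>M\<in>I. \<forall>N. size N = d \<and> N < M \<longrightarrow> N \<in> I)"

text \<open>Since the multiset order is total, initial segments of one degree form a chain.\<close>

lemma initial_segment_subset:
  assumes I: "initial_segment d I" and J: "initial_segment d J" and "card I \<le> card J"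
  shows "I \<subseteq> J"
proof (rule ccontr)
  assume "\<not> I \<subseteq> J"
  then obtain M where M: "M \<in> I" "M \<notin> J" by blast
  have "N \<in> I" if N: "N \<in> J" for N
  proof -
    have "size N = d" "size M = d" using I J M N unfolding initial_segment_def by blast+
    moreover have "\<not> M < N" using J N M(2) \<open>size M = d\<close> unfolding initial_segment_def by blast
    ultimately show ?thesis
      using I M(1) linorder_less_linear[of N M] unfolding initial_segment_def by blast
  qed
  then have "J \<subset> I" using M by blast
  then have "card J < card I" using I by (intro psubset_card_mono) (auto simp: initial_segment_def)
  then show False using assms(3) by simp
qed

text \<open>If \<open>\<Sum>i=\<delta>..d. k i choose i\<close> is the \<open>d\<close>-binomial expansion of \<open>n\<close> and \<open>r i = k i - i + 1\<close>, then
  \<open>segment \<delta> r d\<close> consists of the \<open>n\<close> smallest monomials of degree \<open>d\<close>. Passing to \<open>k i + 1\<close> and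
  degree \<open>d + 1\<close> does not change the variable indices \<open>r\<close>.\<close>

primrec segment :: "nat \<Rightarrow> (nat \<Rightarrow> nat) \<Rightarrow> nat \<Rightarrow> nat multiset set" where
  "segment \<delta> r 0 = {}"
| "segment \<delta> r (Suc d) = (if Suc d < \<delta> then {} else
     multisets_of_size {..<r (Suc d)} (Suc d) \<union> add_mset (r (Suc d)) ` segment \<delta> r d)"

lemma segment_eq_empty: "d < \<delta> \<Longrightarrow> segment \<delta> r d = {}"
  by (cases d) auto

lemma segment_degree_variables:
  assumes "\<And>i. \<delta> \<le> i \<Longrightarrow> i < d \<Longrightarrow> r i \<le> r (Suc i)" "M \<in> segment \<delta> r d"
  shows "size M = d \<and> set_mset M \<subseteq> {..r d}"
  using assms
proof (induction d arbitrary: M)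
  case (Suc d)
  have "\<not> Suc d < \<delta>" using Suc.prems(2) by (auto split: if_splits)
  then consider "M \<in> multisets_of_size {..<r (Suc d)} (Suc d)" |
    N where "M = add_mset (r (Suc d)) N" "N \<in> segment \<delta> r d"
    using Suc.prems(2) by auto
  then show ?case
  proof cases
    case 1 then show ?thesis by (auto simp: multisets_of_size_def)
  next
    case 2
    then have "\<delta> \<le> d" using segment_eq_empty[of d \<delta> r] by (cases "d < \<delta>") auto
    then have "r d \<le> r (Suc d)" using Suc.prems(1) by simp
    moreover have "size N = d \<and> set_mset N \<subseteq> {..r d}" using Suc.IH[of N] Suc.prems(1) 2 by simp
    ultimately show ?thesis using 2 by auto
  qed
qed simp

lemma finite_segment: "finite (segment \<delta> r d)"
  by (induction d) (auto intro: finite_multisets_of_size)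

text \<open>Each summand counts the monomials of degree \<open>i\<close> in \<open>r i\<close>
  variables; the blocks are disjoint because only the later ones contain
  \<open>r (Suc d)\<close>.\<close>

lemma card_segment:
  "1 \<le> \<delta> \<Longrightarrow> card (segment \<delta> r d) = (\<Sum>i=\<delta>..d. (r i + i - 1) choose i)"
proof (induction d)
  case (Suc d)
  show ?case
  proof (cases "Suc d < \<delta>")
    case False
    have "card (segment \<delta> r (Suc d)) =
        card (multisets_of_size {..<r (Suc d)} (Suc d)) + card (add_mset (r (Suc d)) ` segment \<delta> r d)"
    proof -
      have "multisets_of_size {..<r (Suc d)} (Suc d) \<inter> add_mset (r (Suc d)) ` segment \<delta> r d = {}"
        by (auto simp: multisets_of_size_def)
      then show ?thesis
        using False by (simp add: card_Un_disjoint finite_multisets_of_size finite_segment)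
    qed
    moreover have "card (add_mset (r (Suc d)) ` segment \<delta> r d) = card (segment \<delta> r d)"
      by (intro card_image) (simp add: inj_on_def)
    ultimately show ?thesis
      using Suc False by (simp add: card_multisets_of_size sum.nat_ivl_Suc')
  qed simp
qed simp

text \<open>The multiset order compares largest variables first, so \<open>N\<close> has none above
  those of \<open>M\<close>. Either \<open>N\<close> lies in the block of smaller variables, or the
  common variable \<open>r (Suc d)\<close> cancels and the cofactors are compared.\<close>

lemma segment_down_closed:
  assumes "\<And>i. \<delta> \<le> i \<Longrightarrow> i < d \<Longrightarrow> r i \<le> r (Suc i)" "M \<in> segment \<delta> r d" "size N = d" "N < M"
  shows "N \<in> segment \<delta> r d"
  using assms
proof (induction d arbitrary: M N)
  case (Suc d)
  let ?r = "r (Suc d)"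
  have d: "\<not> Suc d < \<delta>" using Suc.prems(2) by (auto split: if_splits)
  have below: "x \<le> y" if "x \<in># N" "\<And>z. z \<in># M \<Longrightarrow> z \<le> y" for x y
  proof (rule ccontr)
    assume "\<not> x \<le> y"
    then have "M < N" using that by (intro ex_gt_imp_less_multiset) force
    then show False using Suc.prems(4) by simp
  qed
  consider "M \<in> multisets_of_size {..<?r} (Suc d)" |
    M' where "M = add_mset ?r M'" "M' \<in> segment \<delta> r d"
    using Suc.prems(2) d by auto
  then show ?case
  proof cases
    case 1
    then have M: "z < ?r" if "z \<in># M" for z using that by (auto simp: multisets_of_size_def)
    have "x < ?r" if "x \<in># N" for x
    proof -
      have "M \<noteq> {#}" using 1 by (auto simp: multisets_of_size_def)
      then obtain z where "z \<in># M" by blast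
      then have "0 < ?r" using M by fastforce
      have "z \<le> ?r - 1" if "z \<in># M" for z using M[OF that] by simp
      then have "x \<le> ?r - 1" by (rule below[OF that])
      then show ?thesis using \<open>0 < ?r\<close> by simp
    qed
    then have "N \<in> multisets_of_size {..<?r} (Suc d)"
      using Suc.prems(3) by (auto simp: multisets_of_size_def)
    then show ?thesis using d by simp
  next
    case 2
    have "set_mset M \<subseteq> {..?r}" using segment_degree_variables[OF Suc.prems(1,2)] by simp
    then have "z \<le> ?r" if "z \<in># M" for z using that by auto
    then have N: "x \<le> ?r" if "x \<in># N" for x by (rule below[OF that])
    show ?thesis
    proof (cases "?r \<in># N")
      case True
      then obtain N' where N': "N = add_mset ?r N'" by (meson multi_member_split)
      then have "N' < M'" "size N' = d" using Suc.prems(3,4) 2 by auto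
      then have "N' \<in> segment \<delta> r d" using Suc.IH[OF _ 2(2), of N'] Suc.prems(1) by simp
      then show ?thesis using N' d by simp
    next
      case False
      then have "x < ?r" if "x \<in># N" for x using N[OF that] that by (cases "x = ?r") auto
      then have "N \<in> multisets_of_size {..<?r} (Suc d)"
        using Suc.prems(3) by (auto simp: multisets_of_size_def)
      then show ?thesis using d by simp
    qed
  qed
qed simp

text \<open>The shifted index function assigns to degree \<open>i + 1\<close> the variable that
  \<open>r\<close> assigns to degree \<open>i\<close>, so both segments unfold in parallel.\<close>

lemma shadow_segment:
  assumes "1 \<le> \<delta>" "\<And>i. \<delta> \<le> i \<Longrightarrow> i < d \<Longrightarrow> r i \<le> r (Suc i)"
    "add_mset x N \<in> segment (Suc \<delta>) (\<lambda>i. r (i - 1)) (Suc d)"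
  shows "N \<in> segment \<delta> r d"
  using assms(2,3)
proof (induction d arbitrary: x N)
  case 0
  then show ?case using assms(1) by simp
next
  case (Suc d)
  let ?r = "r (Suc d)" and ?s = "\<lambda>i. r (i - 1)"
  have d: "\<not> Suc d < \<delta>" using Suc.prems(2) by (auto split: if_splits)
  consider "add_mset x N \<in> multisets_of_size {..<?r} (Suc (Suc d))" |
    M where "add_mset x N = add_mset ?r M" "M \<in> segment (Suc \<delta>) ?s (Suc d)"
    using Suc.prems(2) d by (auto simp del: segment.simps(2) simp: segment.simps(2)[of _ _ "Suc d"])
  then show ?case
  proof cases
    case 1
    then have "N \<in> multisets_of_size {..<?r} (Suc d)" by (auto simp: multisets_of_size_def)
    then show ?thesis using d by simp
  next
    case 2
    have IH: "N' \<in> segment \<delta> r d" if "M = add_mset y N'" for y N'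
      using Suc.IH[of y N'] Suc.prems(1) 2(2) that by simp
    have "\<delta> \<le> d" using 2(2) segment_eq_empty[of "Suc d" "Suc \<delta>" ?s] by (cases "d < \<delta>") auto
    have "r (i - 1) \<le> r (Suc i - 1)" if "Suc \<delta> \<le> i" "i < Suc d" for i
      using Suc.prems(1)[of "i - 1"] that by (cases i) auto
    then have M: "size M = Suc d" "set_mset M \<subseteq> {..r d}"
      using segment_degree_variables[of "Suc \<delta>" "Suc d" ?s M, OF _ 2(2)] by simp_all
    have rd: "r d \<le> ?r" using Suc.prems(1) \<open>\<delta> \<le> d\<close> by simp
    show ?thesis
    proof (cases "x = ?r")
      \<comment> \<open>Now \<open>N = M\<close> must itself be decomposed: if it contains
        \<open>?r\<close>, induction treats the cofactor; if not, it lies in the block of smaller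
        variables.\<close>
      case True
      then have "N = M" using 2(1) by simp
      show ?thesis
      proof (cases "?r \<in># M")
        case True
        then obtain M' where "M = add_mset ?r M'" by (meson multi_member_split)
        then show ?thesis using IH[of ?r M'] \<open>N = M\<close> d by simp
      next
        case False
        then have "x < ?r" if "x \<in># M" for x using that M(2) rd
          by (metis atMost_iff order_le_less order_trans subsetD)
        then have "M \<in> multisets_of_size {..<?r} (Suc d)"
          using M(1) by (auto simp: multisets_of_size_def)
        then show ?thesis using \<open>N = M\<close> d by simp
      qed
    next
      case False
      then obtain N' where "N = add_mset ?r N'" "M = add_mset x N'"
        using 2(1) by (metis add_eq_conv_ex)
      then show ?thesis using IH[of x N'] d by simp
    qed
  qed
qed

text \<open>Sharpness of Macaulay's bound: \<open>J\<close> is as large as the bound allows for a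
  shadow of at most \<open>n\<close> members.\<close>

lemma initial_segment_growth:
  assumes "1 \<le> d" "0 < n"
  obtains I J :: "nat multiset set" where "initial_segment d I" "card I = n"
    "initial_segment (Suc d) J" "card J = binomial_shift n d 1 1" "shadow J \<subseteq> I"
proof -
  obtain \<delta> k where k: "binomial_expansion n d \<delta> k" using binomial_expansion_exists[OF assms] by blast
  define r where "r i = Suc (k i - i)" for i
  have \<delta>: "1 \<le> \<delta>" "\<delta> \<le> d" and n: "n = (\<Sum>i=\<delta>..d. k i choose i)"
    using k by (auto simp: binomial_expansion_def)
  have mono: "r i \<le> r (Suc i)" if "\<delta> \<le> i" "i < d" for i
  proof -
    have "k i < k (Suc i)" using k that by (simp add: binomial_expansion_def)
    then show ?thesis by (simp add: r_def)
  qed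
  have rk: "r i + i - 1 = k i" if "\<delta> \<le> i" "i \<le> d" for i
    using binomial_expansion_index_le[OF k that] by (simp add: r_def)
  let ?I = "segment \<delta> r d" and ?J = "segment (Suc \<delta>) (\<lambda>i. r (i - 1)) (Suc d)"
  have mono': "r (i - 1) \<le> r (Suc i - 1)" if "Suc \<delta> \<le> i" "i < Suc d" for i
    using mono[of "i - 1"] that by (cases i) auto
  have "initial_segment d ?I"
    unfolding initial_segment_def
    using finite_segment segment_degree_variables[of \<delta> d r] segment_down_closed[of \<delta> d r] mono by blast
  moreover have "card ?I = n"
    unfolding n card_segment[OF \<delta>(1)] using rk by (intro sum.cong) auto
  moreover have "initial_segment (Suc d) ?J"
    unfolding initial_segment_def
    using finite_segment segment_degree_variables[of "Suc \<delta>" "Suc d" "\<lambda>i. r (i - 1)"]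
      segment_down_closed[of "Suc \<delta>" "Suc d" "\<lambda>i. r (i - 1)"] mono' by blast
  moreover have "card ?J = binomial_shift n d 1 1"
  proof -
    have "card ?J = (\<Sum>i=Suc \<delta>..Suc d. (r (i - 1) + i - 1) choose i)"
      by (intro card_segment) simp
    also have "\<dots> = (\<Sum>i=\<delta>..d. (r i + i) choose Suc i)"
      by (subst sum.shift_bounds_cl_Suc_ivl) simp
    also have "\<dots> = (\<Sum>i=\<delta>..d. binom (int (k i) + 1) (int i + 1))"
    proof (rule sum.cong)
      fix i assume "i \<in> {\<delta>..d}"
      then have "r i + i = Suc (k i)" using rk[of i] by (simp add: r_def)
      then show "(r i + i) choose Suc i = binom (int (k i) + 1) (int i + 1)"
        using binom_of_nat[of "Suc (k i)" "Suc i"] by (simp add: add.commute)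
    qed simp
    finally show ?thesis using binomial_shift_eq[OF k] by simp
  qed
  moreover have "shadow ?J \<subseteq> ?I"
    using shadow_segment[of \<delta> d r] \<delta>(1) mono unfolding shadow_def by blast
  ultimately show ?thesis using that by blast
qed

lemma shadow_closed_imp_divisor_closed:
  assumes "shadow X \<subseteq> X" "M \<in> X" "N \<subseteq># M"
  shows "N \<in> X"
proof -
  have "N + K \<in> X \<Longrightarrow> N \<in> X" for K
  proof (induction K)
    case (add x K)
    then have "N + K \<in> shadow X" by (auto simp: shadow_def)
    then show ?case using assms(1) add.IH by blast
  qed simp
  then show ?thesis using assms(2,3) by (metis subset_mset.add_diff_inverse)
qed

text \<open>Macaulay's existence theorem. Initial segments of the prescribed sizes are nested with
  the extremal ones, so each shadow stays inside the segment one degree lower.\<close>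

theorem O_sequence_order_ideal:
  assumes "O_sequence e g"
  obtains Y :: "nat multiset set" where "monomial_order_ideal Y" "\<And>M. M \<in> Y \<Longrightarrow> size M \<le> e"
    "\<And>i. i \<le> e \<Longrightarrow> int (card {M \<in> Y. size M = i}) = g i"
proof -
  have g: "\<And>i. i \<le> e \<Longrightarrow> 0 \<le> g i" "g 0 = 1"
    "\<And>d. 1 \<le> d \<Longrightarrow> d < e \<Longrightarrow> g (d + 1) \<le> int (binomial_shift (nat (g d)) d 1 1)"
    using assms by (auto simp: O_sequence_def)
  have "\<exists>I :: nat multiset set. initial_segment i I \<and> card I = nat (g i)" for i
  proof -
    consider "i = 0" | "nat (g i) = 0" | "1 \<le> i" "0 < nat (g i)" by linarith
    then show ?thesis
    proof cases
      case 1
      then show ?thesis using g(2) by (intro exI[of _ "{{#}}"]) (auto simp: initial_segment_def)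
    next
      case 2
      then show ?thesis by (intro exI[of _ "{}"]) (auto simp: initial_segment_def)
    next
      case 3
      then show ?thesis using initial_segment_growth[OF 3] by metis
    qed
  qed
  then obtain I :: "nat \<Rightarrow> nat multiset set" where
    I: "\<And>i. initial_segment i (I i)" "\<And>i. card (I i) = nat (g i)" by metis
  have size: "size M = i" if "M \<in> I i" for M i using I(1)[of i] that by (simp add: initial_segment_def)
  have sh: "shadow (I (Suc d)) \<subseteq> I d" if d: "Suc d \<le> e" for d
  proof -
    consider "d = 0" | "1 \<le> d" "nat (g d) = 0" | "1 \<le> d" "0 < nat (g d)" by linarith
    then show ?thesis
    proof cases
      case 1
      \<comment> \<open>The growth condition starts in degree 1; in degree 0 the only monomial is
        \<open>{#}\<close>.\<close>
      have "card (I 0) = 1" using I(2)[of 0] g(2) by simp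
      then obtain M where "I 0 = {M}" by (meson card_1_singletonE)
      then have "I 0 = {{#}}" using size[of M 0] by simp
      moreover have "N = {#}" if "add_mset x N \<in> I (Suc 0)" for x N using size[OF that] by simp
      ultimately show ?thesis using 1 by (auto simp: shadow_def)
    next
      case 2
      \<comment> \<open>The convention that the shift of 0 is 0 makes all entries after a zero
        vanish.\<close>
      then have "nat (g (Suc d)) = 0" using g(3)[of d] d by (simp add: binomial_shift_def)
      then have "I (Suc d) = {}" using I[of "Suc d"] by (simp add: initial_segment_def)
      then show ?thesis by (simp add: shadow_def)
    next
      case 3
      obtain K J :: "nat multiset set" where KJ: "initial_segment d K" "card K = nat (g d)"
        "initial_segment (Suc d) J" "card J = binomial_shift (nat (g d)) d 1 1" "shadow J \<subseteq> K"
        using initial_segment_growth[OF 3] .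
      have "K \<subseteq> I d" using KJ I by (intro initial_segment_subset) auto
      moreover have "I (Suc d) \<subseteq> J"
        using KJ I g(3)[of d] 3 d by (intro initial_segment_subset) auto
      then have "shadow (I (Suc d)) \<subseteq> shadow J" by (auto simp: shadow_def)
      ultimately show ?thesis using KJ(5) by blast
    qed
  qed
  let ?Y = "\<Union>i\<le>e. I i"
  have slice: "{M \<in> ?Y. size M = i} = I i" if "i \<le> e" for i using that size by auto
  have "shadow ?Y \<subseteq> ?Y"
  proof
    fix N assume "N \<in> shadow ?Y"
    then obtain x i where x: "add_mset x N \<in> I i" "i \<le> e" by (auto simp: shadow_def)
    then have "i = Suc (size N)" using size[OF x(1)] by simp
    then have "N \<in> I (size N)" using sh[of "size N"] x by (auto simp: shadow_def)
    then show "N \<in> ?Y" using x(2) \<open>i = Suc (size N)\<close> by (intro UN_I[of "size N"]) auto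
  qed
  moreover have "I 0 \<noteq> {}" using I(2)[of 0] g(2) by auto
  moreover have "finite ?Y" using I(1) by (auto simp: initial_segment_def)
  ultimately have "monomial_order_ideal ?Y"
    unfolding monomial_order_ideal_def using shadow_closed_imp_divisor_closed[of ?Y] by blast
  moreover have "size M \<le> e" if "M \<in> ?Y" for M using that size by auto
  moreover have "int (card {M \<in> ?Y. size M = i}) = g i" if "i \<le> e" for i
    using slice[OF that] I(2)[of i] g(1)[OF that] by simp
  ultimately show ?thesis using that[of ?Y] by blast
qed

section \<open>First halves of pure O-sequences\<close>

text \<open>The differences count leading monomials, whose families in consecutive degrees are
  linked by shadows; Macaulay's bound then is the O-sequence condition.\<close>

theorem pure_order_ideal_differentiable:
  fixes X :: "nat multiset set"
  assumes "pure_order_ideal E X" "2 * e \<le> E"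
    and h: "\<And>i. i \<le> e \<Longrightarrow> h i = int (card {M \<in> X. size M = i})"
  shows "differentiable_sequence e h"
proof -
  define g where "g = (\<lambda>i. if i = 0 then h 0 else h i - h (i - 1))"
  have X: "monomial_order_ideal X" "finite X" "X \<noteq> {}" "\<And>M N. M \<in> X \<Longrightarrow> N \<subseteq># M \<Longrightarrow> N \<in> X"
    using assms(1) by (auto simp: pure_order_ideal_def monomial_order_ideal_def)
  have fin: "finite (variables X)" "finite (leading X i)" for i
    using X(2) finite_subset[OF leading_subset, of X i] by (auto simp: variables_def)
  have g: "g (Suc i) = int (card (leading X (Suc i)))" if "Suc i \<le> e" for i
    using card_leading[OF assms(1), of i] h[of i] h[of "Suc i"] that assms(2) by (simp add: g_def)
  have "{#} \<in> X" using X(3) X(4)[of _ "{#}"] by auto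
  then have "{M \<in> X. size M = 0} = {{#}}" by auto
  then have g0: "g 0 = 1" using h[of 0] by (simp add: g_def)
  have "g (d + 1) \<le> int (binomial_shift (nat (g d)) d 1 1)" if d: "1 \<le> d" "d < e" for d
  proof -
    let ?F = "leading X (Suc d)" and ?n = "card (leading X d)"
    have gd: "g d = int ?n" using g[of "d - 1"] d by simp
    have V: "?F \<subseteq> multisets_of_size (variables X) (Suc d)"
      using leading_subset[of X "Suc d"] by (auto simp: multisets_of_size_def variables_def)
    have sh: "card (shadow ?F) \<le> ?n" by (intro card_mono fin shadow_leading X(1))
    have "card ?F \<le> binomial_shift ?n d 1 1"
    proof (cases "?n = 0")
      \<comment> \<open>Sums starting at \<open>Suc d\<close> are empty and give the bound 0, the
        default value of the shift at 0.\<close>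
      case True
      then show ?thesis
        using Macaulay_bound[OF fin(1) V, of "Suc d" "\<lambda>_. 0"] sh by (simp add: binomial_shift_def)
    next
      case False
      then obtain \<delta> k where k: "binomial_expansion ?n d \<delta> k"
        using binomial_expansion_exists[OF d(1), of ?n] by auto
      have "?n = (\<Sum>i=\<delta>..d. k i choose i)" "1 \<le> \<delta>" using k by (auto simp: binomial_expansion_def)
      then show ?thesis
        using Macaulay_bound[OF fin(1) V, of \<delta> "\<lambda>i. int (k i)"] sh binomial_shift_eq[OF k, of 1 1]
        by (simp add: binom_of_nat)
    qed
    then show ?thesis using g[of d] d gd by simp
  qed
  moreover have "0 \<le> g i" if "i \<le> e" for i using g0 g[of "i - 1"] that by (cases i) auto
  ultimately have "O_sequence e g" using g0 by (auto simp: O_sequence_def)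
  then show ?thesis by (simp add: differentiable_sequence_def g_def)
qed

theorem differentiable_first_half:
  assumes "differentiable_sequence e h"
  shows "\<exists>H. pure_O_sequence (2 * e) H \<and> (\<forall>i\<le>e. H i = h i)"
proof -
  define g where "g = (\<lambda>i. if i = 0 then h 0 else h i - h (i - 1))"
  have "O_sequence e g" using assms by (simp add: differentiable_sequence_def g_def)
  then obtain Y :: "nat multiset set" where Y: "monomial_order_ideal Y" "\<And>M. M \<in> Y \<Longrightarrow> size M \<le> e"
    "\<And>i. i \<le> e \<Longrightarrow> int (card {M \<in> Y. size M = i}) = g i"
    by (rule O_sequence_order_ideal) blast
  have Y': "finite Y" "Y \<noteq> {}" "\<And>M N. M \<in> Y \<Longrightarrow> N \<subseteq># M \<Longrightarrow> N \<in> Y"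
    using Y(1) by (auto simp: monomial_order_ideal_def)
  \<comment> \<open>The new variable is 0 and old variables move up by one: \<open>emb j\<close>
    multiplies by its \<open>j\<close>-th power, \<open>pr\<close> sets it to 1.\<close>
  define emb where "emb j N = replicate_mset j 0 + image_mset Suc N" for j N
  define pr where "pr M = image_mset (\<lambda>v. v - 1) (filter_mset (\<lambda>v. v \<noteq> 0) M)" for M :: "nat multiset"
  have count_emb: "count (emb j N) 0 = j" for j N
    by (auto simp: emb_def count_image_mset)
  have pr_emb: "pr (emb j N) = N" for j N
    by (simp add: emb_def pr_def filter_mset_image_mset multiset.map_comp comp_def)
  have emb_pr: "emb (count M 0) (pr M) = M" for M
  proof -
    have "image_mset Suc (pr M) = image_mset (\<lambda>v. v) (filter_mset (\<lambda>v. v \<noteq> 0) M)"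
      unfolding pr_def multiset.map_comp by (rule image_mset_cong) auto
    moreover have "replicate_mset (count M 0) 0 = filter_mset (\<lambda>v. \<not> v \<noteq> 0) M"
      by (simp add: filter_eq_replicate_mset)
    ultimately show ?thesis
      using multiset_partition[of M "\<lambda>v. v \<noteq> 0"] by (simp add: emb_def add.commute)
  qed
  have size_emb: "size (emb j N) = j + size N" for j N by (simp add: emb_def)
  define X where "X = {M. pr M \<in> Y \<and> size M \<le> 2 * e}"
  have emb_X: "emb j N \<in> X \<longleftrightarrow> N \<in> Y \<and> j + size N \<le> 2 * e" for j N
    by (simp add: X_def pr_emb size_emb)
  have "finite X"
  proof (rule finite_subset)
    show "X \<subseteq> (\<lambda>(j, N). emb j N) ` ({..2 * e} \<times> Y)"
    proof
      fix M assume M: "M \<in> X"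
      have "count M 0 \<le> 2 * e" using M count_le_size[of M 0] by (simp add: X_def)
      then show "M \<in> (\<lambda>(j, N). emb j N) ` ({..2 * e} \<times> Y)"
        using M emb_pr[of M] by (intro image_eqI[of _ _ "(count M 0, pr M)"]) (auto simp: X_def)
    qed
  qed (use Y'(1) in auto)
  moreover have "X \<noteq> {}"
  proof -
    obtain N where "N \<in> Y" using Y'(2) by blast
    then have "emb 0 N \<in> X" using Y(2)[of N] by (simp add: emb_X)
    then show ?thesis by blast
  qed
  moreover have "N \<in> X" if "M \<in> X" "N \<subseteq># M" for M N
  proof -
    have "pr N \<subseteq># pr M"
      unfolding pr_def using that(2) by (intro image_mset_subseteq_mono multiset_filter_mono)
    then show ?thesis
      using that size_mset_mono[OF that(2)] Y'(3)[of "pr M" "pr N"] by (simp add: X_def)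
  qed
  ultimately have "monomial_order_ideal X" by (auto simp: monomial_order_ideal_def)
  moreover have "size M = 2 * e" if M: "maximal_monomial X M" for M
  proof (rule ccontr)
    assume ne: "size M \<noteq> 2 * e"
    have MX: "M \<in> X" using M by (simp add: maximal_monomial_def)
    \<comment> \<open>Below degree \<open>2 * e\<close>, multiplication by the new variable stays in
      \<open>X\<close>, so \<open>M\<close> is not maximal.\<close>
    then have "pr (add_mset 0 M) = pr M" "size M < 2 * e" using ne by (auto simp: X_def pr_def)
    then have "add_mset 0 M \<in> X" using MX by (simp add: X_def)
    moreover have "M \<subseteq># add_mset 0 M" by simp
    ultimately have "add_mset 0 M = M" using M unfolding maximal_monomial_def by blast
    then show False by simp
  qed
  ultimately have pure: "pure_order_ideal (2 * e) X" by (simp add: pure_order_ideal_def)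
  have "int (card {M \<in> X. size M = i}) = h i" if i: "i \<le> e" for i
  proof -
    \<comment> \<open>The degree \<open>i\<close> determines the exponent of the new variable, and
      \<open>i \<le> e\<close> respects the degree bound of \<open>X\<close>.\<close>
    have "bij_betw pr {M \<in> X. size M = i} {N \<in> Y. size N \<le> i}"
    proof (rule bij_betw_byWitness[where f' = "\<lambda>N. emb (i - size N) N"])
      show "\<forall>M\<in>{M \<in> X. size M = i}. emb (i - size (pr M)) (pr M) = M"
      proof
        fix M assume "M \<in> {M \<in> X. size M = i}"
        then have "count M 0 + size (pr M) = i" using size_emb[of "count M 0" "pr M"] emb_pr[of M] by simp
        then show "emb (i - size (pr M)) (pr M) = M" using emb_pr[of M] by (metis diff_add_inverse2)
      qed
      show "\<forall>N\<in>{N \<in> Y. size N \<le> i}. pr (emb (i - size N) N) = N" by (simp add: pr_emb)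
      show "pr ` {M \<in> X. size M = i} \<subseteq> {N \<in> Y. size N \<le> i}"
      proof safe
        fix M assume "M \<in> X"
        then show "pr M \<in> Y" by (simp add: X_def)
        show "size (pr M) \<le> size M" using size_emb[of "count M 0" "pr M"] emb_pr[of M] by simp
      qed
      show "(\<lambda>N. emb (i - size N) N) ` {N \<in> Y. size N \<le> i} \<subseteq> {M \<in> X. size M = i}"
        using i by (auto simp: emb_X size_emb)
    qed
    then have "card {M \<in> X. size M = i} = card {N \<in> Y. size N \<le> i}" by (rule bij_betw_same_card)
    also have "{N \<in> Y. size N \<le> i} = (\<Union>l\<le>i. {N \<in> Y. size N = l})" by auto
    also have "card \<dots> = (\<Sum>l\<le>i. card {N \<in> Y. size N = l})"
      using Y'(1) by (intro card_UN_disjoint) auto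
    also have "int \<dots> = (\<Sum>l\<le>i. g l)" using Y(3) i by simp
    also have "\<dots> = h i" by (induction i) (auto simp: g_def)
    finally show ?thesis .
  qed
  then show ?thesis
    using pure unfolding pure_O_sequence_def
    by (intro exI[of _ "\<lambda>i. int (card {M \<in> X. size M = i})"]) auto
qed

theorem theorem3p1:
  fixes e :: nat and h :: "nat \<Rightarrow> int"
  assumes "O_sequence e h"
  shows "(\<exists>E H. pure_O_sequence E H \<and> E div 2 = e \<and> (\<forall>i\<le>e. H i = h i))
           \<longleftrightarrow> differentiable_sequence e h"
proof
  assume "\<exists>E H. pure_O_sequence E H \<and> E div 2 = e \<and> (\<forall>i\<le>e. H i = h i)"
  then obtain E H where "pure_O_sequence E H" and E: "E div 2 = e" and H: "\<forall>i\<le>e. H i = h i"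
    by blast
  then obtain X :: "nat multiset set" where X: "pure_order_ideal E X"
    and HX: "\<forall>i\<le>E. H i = int (card {M \<in> X. size M = i})"
    unfolding pure_O_sequence_def by blast
  \<comment> \<open>Keeps each passage from degree \<open>i < e\<close> to \<open>Suc i\<close>
    strictly below the middle.\<close>
  have E': "2 * e \<le> E" using E by linarith
  have "h i = int (card {M \<in> X. size M = i})" if "i \<le> e" for i
    using H HX E' that by simp
  then show "differentiable_sequence e h"
    by (rule pure_order_ideal_differentiable[OF X E'])
next
  assume "differentiable_sequence e h"
  then obtain H where "pure_O_sequence (2 * e) H" "\<forall>i\<le>e. H i = h i"
    using differentiable_first_half by blast
  then show "\<exists>E H. pure_O_sequence E H \<and> E div 2 = e \<and> (\<forall>i\<le>e. H i = h i)"
    by (intro exI[of _ "2 * e"] exI[of _ H]) simp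
qed

end
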